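(* Consider a system of $N$ qubits placed on the sites of a lattice, with a target Hamiltonian $H$ and an actual Hamiltonian $$H' = H + \sum_{i=1}^M g_i V_i,$$ where $M=\mathcal{O}(N)$, each $V_i$ is a local Hermitian operator with $\|V_i\|\le 1$, and $g_1,\dots,g_M$ are independent $\chi$-deformed Gaussian random variables with parameters $\delta>0$ and $\Gamma\in(0,+\infty]$. Suppose $\sqrt{N}t\delta\le 1$. Then for any density matrix $\rho$ and observable $O$, with $O'(t)=e^{iH't}Oe^{-iH't}$, $$\big|\mathrm{tr}[\rho O'(t)] - \mathbb{E}[\mathrm{tr}[\rho O'(t)]]\big| \le 2a\|O\|\sqrt{M}t\delta = \mathcal{O}(a\|O\|\sqrt{N}t\delta)$$ with probability at least $1-2e^{-ca^2}$, for arbitrary $a>0$ and some absolute constant $c>0$.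
   Context: A random variable $g$ is a $\chi$-deformed Gaussian random variable (with parameters $\delta>0$, $\Gamma\in(0,+\infty]$) if $g=\chi(\theta)$ for some $\theta\sim\mathcal{N}(0,1)$, where $\chi:\mathbb{R}\to\mathbb{R}$ is a strictly monotonically increasing differentiable function with $|\mathrm{d}\chi(\theta)/\mathrm{d}\theta|\le\delta$ for all $\theta$, $\chi(0)=0$, $\lim_{\theta\to+\infty}\chi(\theta)=\Gamma$, $\lim_{\theta\to-\infty}\chi(\theta)=-\Gamma$, and $\mathbb{E}[\chi(\theta)]=0$. Independence of the $g_i$ means the underlying Gaussians $\theta_i$ are independent; the expectation is over $\{g_i\}$. $\|\cdot\|$ denotes the operator norm. The $\mathcal{O}(\cdot)$ notation hides constants independent of $N$, $t$, $\delta$, $a$, $\rho$, $O$. *)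

theory Defs
  imports "Jordan_Normal_Form.Matrix" "HOL-Probability.Probability"
begin

text \<open>Operators on N qubits are complex 2^N x 2^N matrices; the basis state with index
  x < 2^N corresponds to the bit string whose j-th bit (site j) is qbit j x.\<close>

definition qbit :: "nat \<Rightarrow> nat \<Rightarrow> bool" where
  "qbit j x \<longleftrightarrow> odd (x div 2 ^ j)"

definition is_op :: "nat \<Rightarrow> complex mat \<Rightarrow> bool" where
  "is_op N A \<longleftrightarrow> A \<in> carrier_mat (2 ^ N) (2 ^ N)"

definition hermitian :: "complex mat \<Rightarrow> bool" where
  "hermitian A \<longleftrightarrow> square_mat A \<and>
     (\<forall>i < dim_row A. \<forall>j < dim_row A. A $$ (i, j) = cnj (A $$ (j, i)))"

definition mtrace :: "complex mat \<Rightarrow> complex" where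
  "mtrace A = (\<Sum>i < dim_row A. A $$ (i, i))"

definition vnorm :: "complex Matrix.vec \<Rightarrow> real" where
  "vnorm v = sqrt (\<Sum>i < dim_vec v. (cmod (v $ i))\<^sup>2)"

definition op_norm :: "complex mat \<Rightarrow> real" where
  "op_norm A = Sup {vnorm (A *\<^sub>v v) | v. v \<in> carrier_vec (dim_col A) \<and> vnorm v \<le> 1}"

definition mat_exp :: "complex mat \<Rightarrow> complex mat" where
  "mat_exp A = Matrix.mat (dim_row A) (dim_col A) (\<lambda>(i, j). \<Sum>k. (A ^\<^sub>m k) $$ (i, j) / of_nat (fact k))"

definition density_matrix :: "nat \<Rightarrow> complex mat \<Rightarrow> bool" where
  "density_matrix N \<rho> \<longleftrightarrow> is_op N \<rho> \<and> hermitian \<rho> \<and>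
     (\<forall>v \<in> carrier_vec (2 ^ N).
        0 \<le> Re (\<Sum>i < 2 ^ N. \<Sum>j < 2 ^ N. cnj (v $ i) * \<rho> $$ (i, j) * v $ j)) \<and>
     mtrace \<rho> = 1"

text \<open>V acts only on the sites in S, i.e. V = W_S \<otimes> Id on the complement of S.\<close>
definition acts_on :: "nat \<Rightarrow> nat set \<Rightarrow> complex mat \<Rightarrow> bool" where
  "acts_on N S V \<longleftrightarrow> S \<subseteq> {..<N} \<and>
     (\<forall>x < 2 ^ N. \<forall>y < 2 ^ N.
        (\<exists>j < N. j \<notin> S \<and> qbit j x \<noteq> qbit j y) \<longrightarrow> V $$ (x, y) = 0) \<and>
     (\<forall>x < 2 ^ N. \<forall>y < 2 ^ N. \<forall>x' < 2 ^ N. \<forall>y' < 2 ^ N.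
        (\<forall>j \<in> S. qbit j x = qbit j x' \<and> qbit j y = qbit j y') \<and>
        (\<forall>j < N. j \<notin> S \<longrightarrow> qbit j x = qbit j y \<and> qbit j x' = qbit j y')
        \<longrightarrow> V $$ (x, y) = V $$ (x', y'))"

definition local_op :: "nat \<Rightarrow> nat \<Rightarrow> complex mat \<Rightarrow> bool" where
  "local_op N k V \<longleftrightarrow> (\<exists>S. card S \<le> k \<and> acts_on N S V)"

definition pert_ham :: "nat \<Rightarrow> complex mat \<Rightarrow> nat \<Rightarrow> (nat \<Rightarrow> real) \<Rightarrow> (nat \<Rightarrow> complex mat) \<Rightarrow> complex mat" where
  "pert_ham N H M g V = Matrix.mat (2 ^ N) (2 ^ N)
     (\<lambda>(i, j). H $$ (i, j) + (\<Sum>l < M. complex_of_real (g l) * V l $$ (i, j)))"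

definition heis :: "complex mat \<Rightarrow> real \<Rightarrow> complex mat \<Rightarrow> complex mat" where
  "heis H' t Ob = mat_exp ((\<i> * of_real t) \<cdot>\<^sub>m H') * Ob * mat_exp ((- \<i> * of_real t) \<cdot>\<^sub>m H')"

definition std_gauss :: "real measure" where
  "std_gauss = density lborel std_normal_density"

definition chi_deformed :: "real \<Rightarrow> ereal \<Rightarrow> (real \<Rightarrow> real) \<Rightarrow> bool" where
  "chi_deformed \<delta> Gam chi \<longleftrightarrow> strict_mono chi \<and>
     (\<forall>\<theta>. \<exists>D. (chi has_real_derivative D) (at \<theta>) \<and> \<bar>D\<bar> \<le> \<delta>) \<and>
     chi 0 = 0 \<and>
     ((\<lambda>\<theta>. ereal (chi \<theta>)) \<longlongrightarrow> Gam) at_top \<and>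
     ((\<lambda>\<theta>. ereal (chi \<theta>)) \<longlongrightarrow> - Gam) at_bot \<and>
     integral\<^sup>L std_gauss chi = 0"

text \<open>Joint law of M independent standard Gaussians \<theta>_0..\<theta>_{M-1}; g_i = chi_i(\<theta>_i).\<close>
definition gauss_space :: "nat \<Rightarrow> (nat \<Rightarrow> real) measure" where
  "gauss_space M = PiM {..<M} (\<lambda>_. std_gauss)"

end

theory Submission
  imports Defs
begin

text \<open>
  Changing one Gaussian \<open>\<theta>\<^sub>i\<close> moves the Hamiltonian by at most \<open>\<delta> \<bar>d\<theta>\<^sub>i\<bar>\<close> in operator norm, and hence,
  by a Duhamel interpolation between the two unitary evolutions, moves the expected observable by
  at most \<open>L \<bar>d\<theta>\<^sub>i\<bar>\<close> with \<open>L = 2 t \<delta> \<parallel>O\<parallel>\<close>. A function that is \<open>L\<close>-Lipschitz in each coordinate is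
  concentrated at scale \<open>L sqrt M\<close>: integrating out one Gaussian at a time, each step multiplies the
  centred exponential moment at \<open>s\<close> by at most \<open>exp ((s L)\<^sup>2)\<close>. So Gaussian concentration for the
  Euclidean Lipschitz constant is not needed.
\<close>

section \<open>Concentration for coordinatewise Lipschitz functions of Gaussians\<close>

text \<open>No estimate may depend on the dimension \<open>2 ^ N\<close>. Traces against
  \<open>\<rho>\<close> are therefore bounded through the operator norm, using trace one and
  unitarity; sums over matrix entries serve only for finiteness and for convergence of series. A
  function with constant \<open>L\<close> in each of \<open>M\<close> coordinates has Euclidean
  Lipschitz constant at most \<open>L * sqrt M\<close>, so the elementary route reaches the scale of
  the sharp Gaussian inequality and loses only in the constant \<open>c\<close>. The value 1/16
  arises as follows. Symmetrization replaces the variance of one Gaussian by that of a difference of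
  two, which doubles the exponent \<open>(s * L)\<^sup>2 / 2\<close> of the optimal moment bound;
  the one-sided tail at distance \<open>b * (sqrt M * L)\<close> becomes
  \<open>exp (- b\<^sup>2 / 4)\<close>. The expected observable is treated as a complex number, so
  its real and imaginary parts each get the radius divided by \<open>sqrt 2\<close>, with tails
  \<open>exp (- a\<^sup>2 / 8)\<close>. Four such tails are brought back to the prefactor 2 by
  halving the exponent once more.\<close>

lemma sets_std_gauss [measurable_cong, simp]: "sets std_gauss = sets borel"
  and space_std_gauss [simp]: "space std_gauss = UNIV"
  by (simp_all add: std_gauss_def)

lemma prob_space_std_gauss: "prob_space std_gauss"
  unfolding std_gauss_def by (rule prob_space_normal_density) simp

lemma measure_std_gauss_UNIV [simp]: "measure std_gauss UNIV = 1"
  using prob_space.prob_space[OF prob_space_std_gauss] by simp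

lemma prob_space_gauss_space: "prob_space (gauss_space M)"
  unfolding gauss_space_def by (intro prob_space_PiM prob_space_std_gauss)

text \<open>Completing the square: tilting the standard density by \<open>exp (s * x)\<close> gives
  the density with mean \<open>s\<close>, of total mass 1, times
  \<open>exp (s\<^sup>2 / 2)\<close>.\<close>

lemma std_gauss_exp:
  "has_bochner_integral std_gauss (\<lambda>x. exp (s * x)) (exp (s\<^sup>2 / 2))"
proof -
  have eq: "std_normal_density x * exp (s * x) = exp (s\<^sup>2 / 2) * normal_density s 1 x" for x
    by (simp add: normal_density_def flip: exp_add) (simp add: power2_eq_square field_simps)
  have "has_bochner_integral lborel (\<lambda>x. exp (s\<^sup>2 / 2) * normal_density s 1 x) (exp (s\<^sup>2 / 2) * 1)"
    by (intro has_bochner_integral_mult_right) (simp add: has_bochner_integral_iff)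
  then show ?thesis
    unfolding std_gauss_def
    by (intro has_bochner_integral_density) (simp_all add: eq)
qed

text \<open>The l1 distance encodes a common Lipschitz constant in each coordinate. Quantifying over
  all of \<open>nat \<Rightarrow> real\<close> makes \<open>f\<close> depend on the coordinates
  below \<open>M\<close> only and allows updates \<open>x(M := y)\<close> without membership
  conditions. The codomain is general so as to cover a complex function together with its real and
  imaginary parts.\<close>

definition l1_lipschitz :: "nat \<Rightarrow> real \<Rightarrow> ((nat \<Rightarrow> real) \<Rightarrow> 'a::real_normed_vector) \<Rightarrow> bool" where
  "l1_lipschitz M L f \<longleftrightarrow> (\<forall>x y. norm (f x - f y) \<le> L * (\<Sum>i<M. \<bar>x i - y i\<bar>))"

lemma l1_lipschitzD: "l1_lipschitz M L f \<Longrightarrow> norm (f x - f y) \<le> L * (\<Sum>i<M. \<bar>x i - y i\<bar>)"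
  by (simp add: l1_lipschitz_def)

lemma l1_lipschitz_borel_measurable:
  fixes f :: "(nat \<Rightarrow> real) \<Rightarrow> 'a::{real_normed_vector, second_countable_topology}"
  assumes "l1_lipschitz M L f"
  shows "f \<in> borel_measurable (gauss_space M)"
proof -
  \<comment> \<open>\<open>f\<close> is defined on all of \<open>nat \<Rightarrow> real\<close>, where product and Borel sets agree, whereas points of
    \<open>gauss_space M\<close> are \<open>undefined\<close> off \<open>{..<M}\<close>; \<open>r\<close> mediates between the two.\<close>
  define r where "r = (\<lambda>x::nat \<Rightarrow> real. \<lambda>i. if i < M then x i else 0)"
  have "continuous_on UNIV f"
  proof (unfold continuous_on_def, intro ballI)
    fix x :: "nat \<Rightarrow> real"
    have "continuous_on UNIV (\<lambda>y. L * (\<Sum>i<M. \<bar>y i - x i\<bar>))"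
      by (intro continuous_intros continuous_on_product_coordinates)
    then have "((\<lambda>y. L * (\<Sum>i<M. \<bar>y i - x i\<bar>)) \<longlongrightarrow> L * (\<Sum>i<M. \<bar>x i - x i\<bar>)) (at x)"
      unfolding continuous_on_def by blast
    then have "((\<lambda>y. L * (\<Sum>i<M. \<bar>y i - x i\<bar>)) \<longlongrightarrow> 0) (at x)"
      by simp
    then have "((\<lambda>y. f y - f x) \<longlongrightarrow> 0) (at x)"
      by (rule Lim_null_comparison[rotated]) (use l1_lipschitzD[OF assms] in auto)
    then show "(f \<longlongrightarrow> f x) (at x)"
      by (simp add: LIM_zero_iff)
  qed
  then have "f \<in> borel_measurable borel"
    by (rule borel_measurable_continuous_onI)
  then have "f \<in> borel_measurable (PiM UNIV (\<lambda>_. borel))"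
    using measurable_cong_sets[OF sets_PiM_equal_borel refl] by blast
  moreover have "r \<in> measurable (gauss_space M) (PiM UNIV (\<lambda>_. borel))"
    unfolding gauss_space_def
  proof (rule measurable_PiM_single')
    fix i :: nat
    show "(\<lambda>x. r x i) \<in> borel_measurable (PiM {..<M} (\<lambda>_. std_gauss))"
    proof (cases "i < M")
      case True
      have "(\<lambda>x. x i) \<in> measurable (PiM {..<M} (\<lambda>_. std_gauss)) std_gauss"
        by (rule measurable_component_singleton) (use True in simp)
      then have "(\<lambda>x. x i) \<in> borel_measurable (PiM {..<M} (\<lambda>_. std_gauss))"
        using measurable_cong_sets[OF refl sets_std_gauss] by blast
      then show ?thesis
        using True by (simp add: r_def)
    next
      case False
      then show ?thesis by (simp add: r_def)
    qed
  qed simp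
  ultimately have "(\<lambda>x. f (r x)) \<in> borel_measurable (gauss_space M)"
    by (rule measurable_compose[rotated])
  moreover have "f (r x) = f x" for x
  proof -
    have "(\<Sum>i<M. \<bar>r x i - x i\<bar>) = 0" by (simp add: r_def)
    then show ?thesis using l1_lipschitzD[OF assms, of "r x" x] by simp
  qed
  ultimately show ?thesis
    by simp
qed

lemma lipschitz_borel_measurable:
  fixes h :: "real \<Rightarrow> real"
  assumes lip: "\<And>x y. \<bar>h x - h y\<bar> \<le> L * \<bar>x - y\<bar>"
  shows "h \<in> borel_measurable borel"
proof (rule borel_measurable_continuous_onI)
  \<comment> \<open>\<open>lipschitz_on\<close> includes nonnegativity of its constant; passing to
    \<open>\<bar>L\<bar>\<close> avoids deriving the sign of \<open>L\<close>.\<close>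
  have "\<bar>L\<bar>-lipschitz_on UNIV h"
    using order_trans[OF lip mult_right_mono[OF abs_ge_self abs_ge_zero]]
    by (intro lipschitz_onI) (simp_all add: dist_real_def)
  then show "continuous_on UNIV h"
    by (rule lipschitz_on_continuous_on)
qed

text \<open>Symmetrization: for an independent copy \<open>y\<close> the moment is at most the expectation of
  \<open>cosh (s * (h x - h y)) \<le> cosh (s * L * (x - y))\<close>, which is explicit for Gaussians.\<close>
lemma std_gauss_subgaussian:
  fixes h :: "real \<Rightarrow> real"
  assumes lip: "\<And>x y. \<bar>h x - h y\<bar> \<le> L * \<bar>x - y\<bar>" and bd: "\<And>x. \<bar>h x\<bar> \<le> B"
  shows "(\<integral>x. exp (s * (h x - integral\<^sup>L std_gauss h)) \<partial>std_gauss) \<le> exp ((s * L)\<^sup>2)"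
proof -
  interpret prob_space std_gauss by (rule prob_space_std_gauss)
  define m where "m = integral\<^sup>L std_gauss h"
  define u where "u x = s * (h x - m)" for x
  have hm[measurable]: "h \<in> borel_measurable borel"
    by (rule lipschitz_borel_measurable[OF lip])
  have int_h: "integrable std_gauss h"
    by (rule integrable_const_bound[where B=B]) (use bd in auto)
  have um[measurable]: "u \<in> borel_measurable borel"
    unfolding u_def by measurable
  have ub: "\<bar>u x\<bar> \<le> \<bar>s\<bar> * (B + \<bar>m\<bar>)" for x
    unfolding u_def abs_mult by (intro mult_left_mono) (use bd[of x] in auto)
  have ie: "integrable std_gauss (\<lambda>x. exp (u x))" "integrable std_gauss (\<lambda>x. exp (- u x))"
    by (rule integrable_const_bound[where B="exp (\<bar>s\<bar> * (B + \<bar>m\<bar>))"]; use ub in \<open>force simp: abs_le_iff\<close>)+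
  define P where "P = (\<integral>x. exp (u x) \<partial>std_gauss)"
  define Q where "Q = (\<integral>x. exp (- u x) \<partial>std_gauss)"
  have gi: "integrable std_gauss (\<lambda>x. exp (r * x))" "(\<integral>x. exp (r * x) \<partial>std_gauss) = exp (r\<^sup>2 / 2)" for r
    using std_gauss_exp[of r] by (simp_all add: has_bochner_integral_iff)
  define v where "v = s * L"
  \<comment> \<open>Both sides are twice a hyperbolic cosine, expanded into products of a function
    of \<open>x\<close> and a function of \<open>y\<close>, so that the expectation over the
    independent pair can be taken one variable at a time and no product measure appears.\<close>
  have cosh_le: "exp (u x) * exp (- u y) + exp (- u x) * exp (u y)
       \<le> exp (v * x) * exp (- v * y) + exp (- v * x) * exp (v * y)" for x y
  proof -
    have "\<bar>u x - u y\<bar> = \<bar>s\<bar> * \<bar>h x - h y\<bar>"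
      by (simp add: u_def abs_mult[symmetric] algebra_simps)
    also have "\<dots> \<le> \<bar>s\<bar> * \<bar>L * (x - y)\<bar>"
      using lip[of x y] by (intro mult_left_mono) (simp_all add: abs_mult, meson abs_ge_self abs_ge_zero mult_right_mono order_trans)
    also have "\<dots> = \<bar>v * (x - y)\<bar>"
      by (simp add: v_def abs_mult)
    finally have "cosh (u x - u y) \<le> cosh (v * (x - y))"
      using cosh_real_nonneg_le_iff[of "\<bar>u x - u y\<bar>" "\<bar>v * (x - y)\<bar>"] by (simp del: abs_mult)
    then show ?thesis
      by (simp add: cosh_field_def algebra_simps flip: exp_add)
  qed
  have step: "exp (u x) * Q + exp (- u x) * P
       \<le> exp (v * x) * exp (v\<^sup>2 / 2) + exp (- v * x) * exp (v\<^sup>2 / 2)" for x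
  proof -
    have "(\<integral>y. exp (u x) * exp (- u y) + exp (- u x) * exp (u y) \<partial>std_gauss)
      \<le> (\<integral>y. exp (v * x) * exp (- v * y) + exp (- v * x) * exp (v * y) \<partial>std_gauss)"
      by (intro integral_mono cosh_le Bochner_Integration.integrable_add integrable_mult_right ie gi)
    then show ?thesis
      using gi[of v] gi[of "-v"] ie by (simp add: P_def Q_def)
  qed
  have "(\<integral>x. exp (u x) * Q + exp (- u x) * P \<partial>std_gauss)
     \<le> (\<integral>x. exp (v * x) * exp (v\<^sup>2 / 2) + exp (- v * x) * exp (v\<^sup>2 / 2) \<partial>std_gauss)"
    by (intro integral_mono step Bochner_Integration.integrable_add integrable_mult_left ie gi)
  also have "\<dots> = 2 * exp (v\<^sup>2)"
    using gi[of v] gi[of "-v"] by simp (simp flip: exp_add)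
  finally have PQ: "P * Q \<le> exp (v\<^sup>2)"
    using ie by (simp add: P_def Q_def mult.commute)
  have "(\<integral>x. 1 - u x \<partial>std_gauss) \<le> Q"
    unfolding Q_def
  proof (rule integral_mono)
    show "integrable std_gauss (\<lambda>x. 1 - u x)"
      using int_h by (simp add: u_def)
    show "1 - u x \<le> exp (- u x)" for x
      using exp_ge_add_one_self[of "- u x"] by simp
  qed (rule ie)
  moreover have "(\<integral>x. 1 - u x \<partial>std_gauss) = 1"
    using int_h by (simp add: u_def m_def)
  ultimately have "1 \<le> Q" by simp
  moreover have "0 \<le> P" by (simp add: P_def)
  ultimately have "P \<le> P * Q" using mult_left_mono[of 1 Q P] by simp
  with PQ show ?thesis by (simp add: P_def u_def v_def m_def)
qed

section \<open>Exponential moments and tails on the product space\<close>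

lemma integrable_exp_l1_lipschitz:
  fixes f :: "(nat \<Rightarrow> real) \<Rightarrow> real"
  assumes "l1_lipschitz M L f" and bd: "\<And>x. \<bar>f x\<bar> \<le> B"
  shows "integrable (gauss_space M) (\<lambda>x. exp (s * (f x - m)))"
proof -
  interpret prob_space "gauss_space M" by (rule prob_space_gauss_space)
  have [measurable]: "f \<in> borel_measurable (gauss_space M)"
    by (rule l1_lipschitz_borel_measurable[OF assms(1)])
  have "s * (f x - m) \<le> \<bar>s\<bar> * (B + \<bar>m\<bar>)" for x
  proof -
    have "s * (f x - m) \<le> \<bar>s\<bar> * \<bar>f x - m\<bar>" by (metis abs_ge_self abs_mult)
    also have "\<dots> \<le> \<bar>s\<bar> * (B + \<bar>m\<bar>)" by (intro mult_left_mono) (use bd[of x] in auto)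
    finally show ?thesis .
  qed
  then show ?thesis
    by (intro integrable_const_bound[where B="exp (\<bar>s\<bar> * (B + \<bar>m\<bar>))"]) auto
qed

lemma integrable_l1_lipschitz:
  fixes f :: "(nat \<Rightarrow> real) \<Rightarrow> 'a::{banach, second_countable_topology}"
  assumes "l1_lipschitz M L f" and bd: "\<And>x. norm (f x) \<le> B"
  shows "integrable (gauss_space M) f"
proof -
  interpret prob_space "gauss_space M" by (rule prob_space_gauss_space)
  show ?thesis
    by (rule integrable_const_bound[where B=B])
      (use bd l1_lipschitz_borel_measurable[OF assms(1)] in auto)
qed

text \<open>The deviation splits as \<open>f - m = (f - h) + (h - m)\<close>, with \<open>h\<close>
  the mean over the last coordinate. The inner moment is bounded uniformly in the other coordinates
  by the one-dimensional estimate. Averaging preserves both \<open>L\<close> and \<open>B\<close>,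
  so the induction hypothesis applies to \<open>h\<close>.\<close>

lemma gauss_space_subgaussian:
  fixes f :: "(nat \<Rightarrow> real) \<Rightarrow> real"
  assumes "l1_lipschitz M L f" "\<And>x. \<bar>f x\<bar> \<le> B"
  shows "(\<integral>x. exp (s * (f x - integral\<^sup>L (gauss_space M) f)) \<partial>gauss_space M) \<le> exp (real M * (s * L)\<^sup>2)"
  using assms
proof (induction M arbitrary: f)
  case 0
  have "f x = f y" for x y
    using l1_lipschitzD[OF 0(1), of x y] by simp
  then have "f = (\<lambda>x. f undefined)" by auto
  then obtain c where f: "f = (\<lambda>_. c)" by metis
  interpret prob_space "gauss_space 0" by (rule prob_space_gauss_space)
  show ?case by (simp add: f prob_space)
next
  case (Suc M)
  interpret G: prob_space "gauss_space M" by (rule prob_space_gauss_space)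
  interpret S: prob_space std_gauss by (rule prob_space_std_gauss)
  interpret product_sigma_finite "\<lambda>_. std_gauss"
    by standard
  have split: "integral\<^sup>L (gauss_space (Suc M)) g
      = (\<integral>x. (\<integral>y. g (x(M := y)) \<partial>std_gauss) \<partial>gauss_space M)"
    if "integrable (gauss_space (Suc M)) g" for g :: "_ \<Rightarrow> real"
    using product_integral_insert[of "{..<M}" M g] that
    by (simp add: gauss_space_def lessThan_Suc)
  define h where "h x = (\<integral>y. f (x(M := y)) \<partial>std_gauss)" for x
  have sum_upd: "(\<Sum>i<Suc M. \<bar>(x(M := y)) i - (x'(M := z)) i\<bar>) = (\<Sum>i<M. \<bar>x i - x' i\<bar>) + \<bar>y - z\<bar>"
    for x x' :: "nat \<Rightarrow> real" and y z by simp
  have lipM: "\<bar>f (x(M := y)) - f (x(M := z))\<bar> \<le> L * \<bar>y - z\<bar>" for x y z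
    using l1_lipschitzD[OF Suc.prems(1), of "x(M := y)" "x(M := z)"]
    by (simp only: sum_upd real_norm_def) simp
  have lipx: "\<bar>f (x(M := y)) - f (x'(M := y))\<bar> \<le> L * (\<Sum>i<M. \<bar>x i - x' i\<bar>)" for x x' y
    using l1_lipschitzD[OF Suc.prems(1), of "x(M := y)" "x'(M := y)"]
    by (simp only: sum_upd real_norm_def) simp
  have int1: "integrable std_gauss (\<lambda>y. f (x(M := y)))" for x
  proof (rule S.integrable_const_bound[where B=B])
    show "(\<lambda>y. f (x(M := y))) \<in> borel_measurable std_gauss"
      using lipschitz_borel_measurable[OF lipM] by (simp cong: measurable_cong_sets)
  qed (use Suc.prems in auto)
  have hB: "\<bar>h x\<bar> \<le> B" for x
  proof -
    have "\<bar>h x\<bar> \<le> (\<integral>y. \<bar>f (x(M := y))\<bar> \<partial>std_gauss)"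
      unfolding h_def by (rule integral_abs_bound)
    also have "\<dots> \<le> (\<integral>y. B \<partial>std_gauss)"
      by (intro integral_mono integrable_abs int1) (use Suc.prems in auto)
    finally show ?thesis by simp
  qed
  have hL: "l1_lipschitz M L h"
    unfolding l1_lipschitz_def
  proof (intro allI)
    fix x x' :: "nat \<Rightarrow> real"
    have "\<bar>h x - h x'\<bar> = \<bar>\<integral>y. f (x(M := y)) - f (x'(M := y)) \<partial>std_gauss\<bar>"
      unfolding h_def using int1 by simp
    also have "\<dots> \<le> (\<integral>y. \<bar>f (x(M := y)) - f (x'(M := y))\<bar> \<partial>std_gauss)"
      by (rule integral_abs_bound)
    also have "\<dots> \<le> (\<integral>y. L * (\<Sum>i<M. \<bar>x i - x' i\<bar>) \<partial>std_gauss)"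
      by (intro integral_mono integrable_abs Bochner_Integration.integrable_diff int1) (use lipx in auto)
    finally show "norm (h x - h x') \<le> L * (\<Sum>i<M. \<bar>x i - x' i\<bar>)" by simp
  qed
  define m where "m = integral\<^sup>L (gauss_space (Suc M)) f"
  have intf: "integrable (gauss_space (Suc M)) f"
    by (rule integrable_l1_lipschitz[OF Suc.prems(1)]) (use Suc.prems in auto)
  have m: "m = integral\<^sup>L (gauss_space M) h"
    unfolding m_def h_def by (rule split[OF intf])
  have "(\<integral>x. exp (s * (f x - m)) \<partial>gauss_space (Suc M))
    = (\<integral>x. (\<integral>y. exp (s * (f (x(M := y)) - m)) \<partial>std_gauss) \<partial>gauss_space M)"
    by (rule split[OF integrable_exp_l1_lipschitz[OF Suc.prems]])
  also have "\<dots> = (\<integral>x. exp (s * (h x - m)) * (\<integral>y. exp (s * (f (x(M := y)) - h x)) \<partial>std_gauss) \<partial>gauss_space M)"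
    by (subst integral_mult_right_zero[symmetric]) (simp add: algebra_simps flip: exp_add)
  \<comment> \<open>\<open>integral_mono'\<close> asks for integrability of the nonnegative upper
    bound alone, so measurability of the inner integral as a function of \<open>x\<close> need not
    be checked.\<close>
  also have "\<dots> \<le> (\<integral>x. exp (s * (h x - m)) * exp ((s * L)\<^sup>2) \<partial>gauss_space M)"
  proof (rule integral_mono')
    fix x
    show "exp (s * (h x - m)) * (\<integral>y. exp (s * (f (x(M := y)) - h x)) \<partial>std_gauss)
       \<le> exp (s * (h x - m)) * exp ((s * L)\<^sup>2)"
      unfolding h_def
      by (intro mult_left_mono std_gauss_subgaussian[where B=B] lipM) (use Suc.prems in auto)
  qed (auto intro!: integrable_mult_left integrable_exp_l1_lipschitz[OF hL hB])
  also have "\<dots> = (\<integral>x. exp (s * (h x - m)) \<partial>gauss_space M) * exp ((s * L)\<^sup>2)"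
    by simp
  also have "\<dots> \<le> exp (real M * (s * L)\<^sup>2) * exp ((s * L)\<^sup>2)"
    unfolding m by (intro mult_right_mono Suc.IH hL hB) auto
  also have "\<dots> = exp (real (Suc M) * (s * L)\<^sup>2)"
    by (simp add: algebra_simps flip: exp_add)
  finally show ?case unfolding m_def .
qed

lemma gauss_space_upper_tail:
  fixes f :: "(nat \<Rightarrow> real) \<Rightarrow> real"
  assumes lip: "l1_lipschitz M L f" and bd: "\<And>x. \<bar>f x\<bar> \<le> B" and "0 < b" "0 < L" "0 < M"
  shows "measure (gauss_space M)
      {x \<in> space (gauss_space M). b * (sqrt M * L) \<le> f x - integral\<^sup>L (gauss_space M) f} \<le> exp (- b\<^sup>2 / 4)"
proof -
  interpret prob_space "gauss_space M" by (rule prob_space_gauss_space)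
  define m where "m = integral\<^sup>L (gauss_space M) f"
  \<comment> \<open>The Chernoff optimum: with \<open>z = s * (sqrt M * L)\<close> the exponent is
    \<open>z\<^sup>2 - b * z\<close>, minimal at \<open>z = b / 2\<close> with value
    \<open>- b\<^sup>2 / 4\<close>.\<close>
  define s where "s = b / (2 * (sqrt M * L))"
  have s: "s > 0" using assms by (simp add: s_def)
  have sL: "s * (sqrt M * L) = b / 2" using assms by (simp add: s_def)
  have "measure (gauss_space M) {x \<in> space (gauss_space M). b * (sqrt M * L) \<le> f x - m}
     = measure (gauss_space M) {x \<in> space (gauss_space M). exp (b\<^sup>2 / 2) \<le> exp (s * (f x - m))}"
  proof -
    have "b * (sqrt M * L) \<le> y \<longleftrightarrow> b\<^sup>2 / 2 \<le> s * y" for y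
    proof -
      have "b\<^sup>2 / 2 = s * (b * (sqrt M * L))"
        using sL by (simp add: power2_eq_square algebra_simps)
      then show ?thesis using s by simp
    qed
    then show ?thesis by simp
  qed
  also have "\<dots> \<le> (\<integral>x. exp (s * (f x - m)) \<partial>gauss_space M) / exp (b\<^sup>2 / 2)"
    by (rule integral_Markov_inequality_measure[where A="{}"])
      (auto intro: integrable_exp_l1_lipschitz[OF lip bd])
  also have "\<dots> \<le> exp (real M * (s * L)\<^sup>2) / exp (b\<^sup>2 / 2)"
    unfolding m_def by (intro divide_right_mono gauss_space_subgaussian[OF lip bd]) auto
  also have "real M * (s * L)\<^sup>2 = (s * (sqrt M * L))\<^sup>2"
    by (simp add: power_mult_distrib)
  also have "exp ((s * (sqrt M * L))\<^sup>2) / exp (b\<^sup>2 / 2) = exp (- b\<^sup>2 / 4)"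
    unfolding sL by (simp add: power_divide flip: exp_diff)
  finally show ?thesis by (simp add: m_def)
qed

text \<open>Absorbs the factor 4 from the union bound over the signs of the real and imaginary parts.\<close>
lemma four_exp_le:
  fixes a :: real
  assumes "1 - 2 * exp (- (1/16) * a\<^sup>2) > 0"
  shows "4 * exp (- a\<^sup>2 / 8) \<le> 2 * exp (- (1/16) * a\<^sup>2)"
proof -
  let ?e = "exp (- (1/16) * a\<^sup>2)"
  have "exp (- a\<^sup>2 / 8) = ?e * ?e" by (simp flip: exp_add)
  moreover have "?e * ?e \<le> ?e * (1/2)" by (intro mult_left_mono) (use assms in auto)
  ultimately show ?thesis by simp
qed

text \<open>If both parts of \<open>f - m\<close> are at most \<open>q\<close> in modulus, then
  \<open>f - m\<close> is at most \<open>sqrt 2 * q\<close>; hence the thresholds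
  \<open>a / sqrt 2\<close> in the four one-sided events.\<close>

lemma gauss_space_concentration:
  fixes f :: "(nat \<Rightarrow> real) \<Rightarrow> complex"
  assumes lip: "l1_lipschitz M L f" and bd: "\<And>x. cmod (f x) \<le> B" and a: "0 < a" and L: "0 \<le> L"
  shows "1 - 2 * exp (- (1/16) * a\<^sup>2)
    \<le> measure (gauss_space M) {x \<in> space (gauss_space M).
          cmod (f x - integral\<^sup>L (gauss_space M) f) \<le> a * (sqrt M * L)}"
proof -
  interpret prob_space "gauss_space M" by (rule prob_space_gauss_space)
  let ?G = "gauss_space M"
  define m where "m = integral\<^sup>L ?G f"
  have fm[measurable]: "f \<in> borel_measurable ?G" by (rule l1_lipschitz_borel_measurable[OF lip])
  have intf: "integrable ?G f" by (rule integrable_l1_lipschitz[OF lip bd])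
  \<comment> \<open>The tail bound divides by \<open>sqrt M * L\<close>, so a radius of zero is
    treated apart; there \<open>f\<close> is constant. When the claimed lower bound is not positive
    there is nothing to prove; otherwise \<open>exp (- (1/16) * a\<^sup>2) < 1/2\<close>, which is
    what absorbs the factor 4.\<close>
  consider "sqrt M * L = 0" | "1 - 2 * exp (- (1/16) * a\<^sup>2) \<le> 0" 
    | "0 < M" "0 < L" "1 - 2 * exp (- (1/16) * a\<^sup>2) > 0"
    using L by fastforce
  then show ?thesis
  proof cases
    case 1
    have "f x = f y" for x y
      using l1_lipschitzD[OF lip, of x y] 1 by auto
    then have "f = (\<lambda>x. f undefined)" by auto
    then obtain c where f: "f = (\<lambda>_. c)" by metis
    have "a * (sqrt M * L) = 0" using 1 by simp
    show ?thesis unfolding f \<open>a * (sqrt M * L) = 0\<close> by (simp add: prob_space)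
  next
    case 2
    then show ?thesis by (meson measure_nonneg order_trans)
  next
    case 3
    define R where "R = a * (sqrt M * L)"
    define T where "T g = {x \<in> space ?G. (a / sqrt 2) * (sqrt M * L) \<le> g x - integral\<^sup>L ?G g}"
      for g :: "(nat \<Rightarrow> real) \<Rightarrow> real"
    have tail: "measure ?G (T g) \<le> exp (- a\<^sup>2 / 8)" "T g \<in> sets ?G"
      if l: "l1_lipschitz M L g" and b: "\<And>x. \<bar>g x\<bar> \<le> B" for g
    proof -
      have [measurable]: "g \<in> borel_measurable ?G" by (rule l1_lipschitz_borel_measurable[OF l])
      show "T g \<in> sets ?G" unfolding T_def by measurable
      show "measure ?G (T g) \<le> exp (- a\<^sup>2 / 8)"
        using gauss_space_upper_tail[OF l b, of "a / sqrt 2"] a 3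
        by (simp add: T_def power_divide)
    qed
    have lips: "l1_lipschitz M L (\<lambda>x. Re (f x))" "l1_lipschitz M L (\<lambda>x. Im (f x))"
      "l1_lipschitz M L (\<lambda>x. - Re (f x))" "l1_lipschitz M L (\<lambda>x. - Im (f x))"
      unfolding l1_lipschitz_def
      using order_trans[OF abs_Re_le_cmod l1_lipschitzD[OF lip]]
        order_trans[OF abs_Im_le_cmod l1_lipschitzD[OF lip]]
      by (simp_all add: abs_minus_commute)
    have bds: "\<bar>Re (f x)\<bar> \<le> B" "\<bar>Im (f x)\<bar> \<le> B" "\<bar>- Re (f x)\<bar> \<le> B" "\<bar>- Im (f x)\<bar> \<le> B" for x
      using bd[of x] abs_Re_le_cmod[of "f x"] abs_Im_le_cmod[of "f x"] by auto
    let ?T1 = "T (\<lambda>x. Re (f x))" and ?T2 = "T (\<lambda>x. Im (f x))"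
      and ?T3 = "T (\<lambda>x. - Re (f x))" and ?T4 = "T (\<lambda>x. - Im (f x))"
    let ?U = "?T1 \<union> ?T2 \<union> ?T3 \<union> ?T4"
    note tails = tail[OF lips(1) bds(1)] tail[OF lips(2) bds(2)]
      tail[OF lips(3) bds(3)] tail[OF lips(4) bds(4)]
    have U: "?U \<in> sets ?G" using tails by auto
    have "measure ?G ?U \<le> measure ?G ?T1 + measure ?G ?T2 + measure ?G ?T3 + measure ?G ?T4"
      by (intro order_trans[OF measure_Un_le] add_mono order_refl) (use tails in auto)
    also have "\<dots> \<le> 4 * exp (- a\<^sup>2 / 8)" using tails by simp
    also have "\<dots> \<le> 2 * exp (- (1/16) * a\<^sup>2)" by (rule four_exp_le) (use 3 in simp)
    finally have mU: "measure ?G ?U \<le> 2 * exp (- (1/16) * a\<^sup>2)" .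
    have incl: "space ?G - ?U \<subseteq> {x \<in> space ?G. cmod (f x - m) \<le> R}"
    proof (intro subsetI CollectI conjI)
      fix x assume x: "x \<in> space ?G - ?U"
      then show "x \<in> space ?G" by simp
      define q where "q = (a / sqrt 2) * (sqrt M * L)"
      have q0: "0 \<le> q" using a L by (simp add: q_def)
      have "\<bar>Re (f x - m)\<bar> \<le> q" "\<bar>Im (f x - m)\<bar> \<le> q"
        using x intf by (auto simp: T_def m_def q_def abs_le_iff integral_Re integral_Im)
      then have "(Re (f x - m))\<^sup>2 \<le> q\<^sup>2" "(Im (f x - m))\<^sup>2 \<le> q\<^sup>2"
        using q0 by (simp_all add: abs_le_square_iff[symmetric])
      then have "cmod (f x - m) \<le> sqrt (2 * q\<^sup>2)"
        unfolding cmod_def by simp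
      also have "\<dots> = R"
        using a L by (simp add: q_def R_def real_sqrt_mult)
      finally show "cmod (f x - m) \<le> R" .
    qed
    have "1 - 2 * exp (- (1/16) * a\<^sup>2) \<le> measure ?G (space ?G - ?U)"
      using prob_compl[OF U] mU by simp
    also have "\<dots> \<le> measure ?G {x \<in> space ?G. cmod (f x - m) \<le> R}"
      by (rule finite_measure_mono[OF incl]) measurable
    finally show ?thesis by (simp add: m_def R_def)
  qed
qed

section \<open>Operator bounds and density matrices\<close>

text \<open>Gives access to the Minkowski and Cauchy-Schwarz inequalities for
  \<open>L2_set\<close>.\<close>

lemma vnorm_L2_set: "vnorm v = L2_set (\<lambda>i. cmod (vec_index v i)) {..<dim_vec v}"
  by (simp add: vnorm_def L2_set_def)

lemma vnorm_nonneg [simp]: "0 \<le> vnorm v"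
  by (simp add: vnorm_L2_set)

lemma vnorm_smult: "vnorm (c \<cdot>\<^sub>v v) = cmod c * vnorm v"
  by (auto simp: vnorm_L2_set L2_set_right_distrib norm_mult intro!: L2_set_cong)

lemma vnorm_add:
  assumes "dim_vec v = dim_vec w"
  shows "vnorm (v + w) \<le> vnorm v + vnorm w"
proof -
  have "vnorm (v + w) \<le> L2_set (\<lambda>i. cmod (vec_index v i) + cmod (vec_index w i)) {..<dim_vec w}"
    unfolding vnorm_L2_set by (auto intro!: L2_set_mono simp: norm_triangle_ineq)
  also have "\<dots> \<le> vnorm v + vnorm w"
    unfolding vnorm_L2_set assms by (rule L2_set_triangle_ineq)
  finally show ?thesis .
qed

lemma cmod_index_le_vnorm: "i < dim_vec v \<Longrightarrow> cmod (vec_index v i) \<le> vnorm v"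
  unfolding vnorm_L2_set by (rule member_le_L2_set) auto

lemma index_mult_mat_vec_sum:
  "A \<in> carrier_mat n m \<Longrightarrow> v \<in> carrier_vec m \<Longrightarrow> i < n \<Longrightarrow>
    vec_index (A *\<^sub>v v) i = (\<Sum>j<m. A $$ (i, j) * vec_index v j)"
  by (auto simp: scalar_prod_def lessThan_atLeast0)

lemma index_mult_mat_sum:
  "A \<in> carrier_mat n m \<Longrightarrow> B \<in> carrier_mat m k \<Longrightarrow> i < n \<Longrightarrow> j < k \<Longrightarrow>
    (A * B) $$ (i, j) = (\<Sum>l<m. A $$ (i, l) * B $$ (l, j))"
  by (auto simp: scalar_prod_def lessThan_atLeast0)

text \<open>Upper bounds for the operator norm, rather than the norm itself: they add and multiply
  without any argument about suprema, and they carry the dimension and the sign of \<open>c\<close>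
  along.\<close>

definition op_bounded :: "nat \<Rightarrow> complex mat \<Rightarrow> real \<Rightarrow> bool" where
  "op_bounded n X c \<longleftrightarrow> X \<in> carrier_mat n n \<and> 0 \<le> c \<and>
     (\<forall>v \<in> carrier_vec n. vnorm (X *\<^sub>v v) \<le> c * vnorm v)"

lemma op_boundedD:
  assumes "op_bounded n X c"
  shows "X \<in> carrier_mat n n" "0 \<le> c" "v \<in> carrier_vec n \<Longrightarrow> vnorm (X *\<^sub>v v) \<le> c * vnorm v"
  using assms by (auto simp: op_bounded_def)

lemma op_bounded_mono: "op_bounded n X c \<Longrightarrow> c \<le> d \<Longrightarrow> op_bounded n X d"
  unfolding op_bounded_def by (meson mult_right_mono order_trans vnorm_nonneg)

lemma op_bounded_mult:
  assumes X: "op_bounded n X c" and Y: "op_bounded n Y d"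
  shows "op_bounded n (X * Y) (c * d)"
  unfolding op_bounded_def
proof (intro conjI ballI)
  note [simp] = op_boundedD(1,2)[OF X] op_boundedD(1,2)[OF Y]
  show "X * Y \<in> carrier_mat n n" by (rule mult_carrier_mat[of _ n n]) simp_all
  show "0 \<le> c * d" by simp
  fix v :: "complex Matrix.vec" assume v: "v \<in> carrier_vec n"
  have "vnorm (X * Y *\<^sub>v v) = vnorm (X *\<^sub>v (Y *\<^sub>v v))"
    by (subst assoc_mult_mat_vec[of _ n n _ n]) (use v in simp_all)
  also have "\<dots> \<le> c * vnorm (Y *\<^sub>v v)"
    by (rule op_boundedD(3)[OF X]) (use v mult_mat_vec_carrier[of Y n n v] in simp)
  also have "\<dots> \<le> c * (d * vnorm v)"
    by (intro mult_left_mono op_boundedD(3)[OF Y] v) simp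
  finally show "vnorm (X * Y *\<^sub>v v) \<le> c * d * vnorm v" by (simp add: mult.assoc)
qed

lemma op_bounded_add:
  assumes X: "op_bounded n X c" and Y: "op_bounded n Y d"
  shows "op_bounded n (X + Y) (c + d)"
  unfolding op_bounded_def
proof (intro conjI ballI)
  note [simp] = op_boundedD(1,2)[OF X] op_boundedD(1,2)[OF Y]
  show "X + Y \<in> carrier_mat n n" "0 \<le> c + d" by simp_all
  fix v :: "complex Matrix.vec" assume v: "v \<in> carrier_vec n"
  have "vnorm ((X + Y) *\<^sub>v v) = vnorm (X *\<^sub>v v + Y *\<^sub>v v)"
    by (subst add_mult_distrib_mat_vec[of _ n n]) (use v in simp_all)
  also have "\<dots> \<le> vnorm (X *\<^sub>v v) + vnorm (Y *\<^sub>v v)"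
    by (rule vnorm_add) (use carrier_matD[OF op_boundedD(1)[OF X]] carrier_matD[OF op_boundedD(1)[OF Y]] in simp)
  also have "\<dots> \<le> (c + d) * vnorm v"
    using op_boundedD(3)[OF X v] op_boundedD(3)[OF Y v] by (simp add: algebra_simps)
  finally show "vnorm ((X + Y) *\<^sub>v v) \<le> (c + d) * vnorm v" .
qed

lemma op_bounded_smult:
  assumes X: "op_bounded n X c"
  shows "op_bounded n (z \<cdot>\<^sub>m X) (cmod z * c)"
  unfolding op_bounded_def
proof (intro conjI ballI)
  show "z \<cdot>\<^sub>m X \<in> carrier_mat n n" "0 \<le> cmod z * c" using op_boundedD[OF X] by simp_all
  fix v :: "complex Matrix.vec" assume v: "v \<in> carrier_vec n"
  have "(z \<cdot>\<^sub>m X) *\<^sub>v v = z \<cdot>\<^sub>v (X *\<^sub>v v)"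
    using op_boundedD(1)[OF X] v by (intro eq_vecI) auto
  then show "vnorm (z \<cdot>\<^sub>m X *\<^sub>v v) \<le> cmod z * c * vnorm v"
    using op_boundedD(3)[OF X v] by (simp add: vnorm_smult mult.assoc mult_left_mono)
qed

lemma op_bounded_diff:
  assumes X: "op_bounded n X c" and Y: "op_bounded n Y d"
  shows "op_bounded n (X - Y) (c + d)"
proof -
  have "X - Y = X + (-1) \<cdot>\<^sub>m Y"
    using op_boundedD(1)[OF X] op_boundedD(1)[OF Y] by (intro eq_matI) auto
  then show ?thesis
    using op_bounded_add[OF X op_bounded_smult[OF Y, of "-1"]] by simp
qed

lemma op_bounded_zero: "op_bounded n (0\<^sub>m n n) 0"
proof -
  have "0\<^sub>m n n *\<^sub>v v = (0 :: complex) \<cdot>\<^sub>v v" if "v \<in> carrier_vec n" for v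
    using that by (intro eq_vecI) (auto simp: scalar_prod_def)
  then show ?thesis by (simp add: op_bounded_def vnorm_smult)
qed

text \<open>A crude bound that grows with the dimension. It supplies finiteness: the set whose
  supremum is \<open>op_norm\<close> is bounded above, and vectors of norm zero have images of norm
  zero.\<close>

lemma op_bounded_entry_sum:
  assumes A: "A \<in> carrier_mat n n"
  shows "op_bounded n A (\<Sum>i<n. \<Sum>j<n. cmod (A $$ (i, j)))"
  unfolding op_bounded_def
proof (intro conjI ballI A sum_nonneg norm_ge_zero)
  fix v :: "complex Matrix.vec" assume v: "v \<in> carrier_vec n"
  have "vnorm (A *\<^sub>v v) \<le> (\<Sum>i<n. cmod (vec_index (A *\<^sub>v v) i))"
    unfolding vnorm_L2_set using L2_set_le_sum[of "{..<n}" "\<lambda>i. cmod (vec_index (A *\<^sub>v v) i)"] A by simp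
  also have "\<dots> \<le> (\<Sum>i<n. \<Sum>j<n. cmod (A $$ (i, j)) * vnorm v)"
  proof (rule sum_mono)
    fix i assume i: "i \<in> {..<n}"
    have "cmod (vec_index (A *\<^sub>v v) i) \<le> (\<Sum>j<n. cmod (A $$ (i, j) * vec_index v j))"
      using index_mult_mat_vec_sum[OF A v, of i] i by (simp add: norm_sum)
    also have "\<dots> \<le> (\<Sum>j<n. cmod (A $$ (i, j)) * vnorm v)"
      using v by (intro sum_mono) (auto simp: norm_mult intro!: mult_left_mono cmod_index_le_vnorm)
    finally show "cmod (vec_index (A *\<^sub>v v) i) \<le> (\<Sum>j<n. cmod (A $$ (i, j)) * vnorm v)" .
  qed
  also have "\<dots> = (\<Sum>i<n. \<Sum>j<n. cmod (A $$ (i, j))) * vnorm v"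
    by (simp add: sum_distrib_right)
  finally show "vnorm (A *\<^sub>v v) \<le> (\<Sum>i<n. \<Sum>j<n. cmod (A $$ (i, j))) * vnorm v" .
qed

text \<open>Once the set under the supremum is known to be bounded, \<open>op_norm\<close> dominates
  its members, and scaling by \<open>1 / vnorm v\<close> extends the bound from the unit ball to
  every vector of positive norm.\<close>

lemma op_bounded_op_norm:
  assumes A: "A \<in> carrier_mat n n"
  shows "op_bounded n A (op_norm A)"
proof -
  define K where "K = (\<Sum>i<n. \<Sum>j<n. cmod (A $$ (i, j)))"
  have K: "op_bounded n A K" unfolding K_def by (rule op_bounded_entry_sum[OF A])
  define S where "S = {vnorm (A *\<^sub>v v) | v. v \<in> carrier_vec (dim_col A) \<and> vnorm v \<le> 1}"
  have dim: "dim_col A = n" using A by simp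
  have bdd: "bdd_above S"
  proof (rule bdd_aboveI)
    fix x assume "x \<in> S"
    then obtain v where v: "v \<in> carrier_vec n" "vnorm v \<le> 1" "x = vnorm (A *\<^sub>v v)"
      by (auto simp: S_def dim)
    then show "x \<le> K"
      using op_boundedD(3)[OF K v(1)] mult_left_mono[OF v(2) op_boundedD(2)[OF K]] by simp
  qed
  have le: "vnorm (A *\<^sub>v v) \<le> op_norm A" if "v \<in> carrier_vec n" "vnorm v \<le> 1" for v
    unfolding op_norm_def S_def[symmetric]
    by (rule cSup_upper[OF _ bdd]) (use that in \<open>auto simp: S_def dim\<close>)
  have "0 \<le> vnorm (A *\<^sub>v 0\<^sub>v n)" by simp
  also have "\<dots> \<le> op_norm A" by (rule le) (auto simp: vnorm_def)
  finally have nn: "0 \<le> op_norm A" .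
  show ?thesis
    unfolding op_bounded_def
  proof (intro conjI ballI A nn)
    fix v :: "complex Matrix.vec" assume v: "v \<in> carrier_vec n"
    show "vnorm (A *\<^sub>v v) \<le> op_norm A * vnorm v"
    proof (cases "vnorm v = 0")
      case True
      then show ?thesis using op_boundedD(3)[OF K v] by simp
    next
      case False
      then have pos: "vnorm v > 0" using vnorm_nonneg[of v] by linarith
      let ?r = "complex_of_real (1 / vnorm v)"
      have "A *\<^sub>v (?r \<cdot>\<^sub>v v) = ?r \<cdot>\<^sub>v (A *\<^sub>v v)"
        using A v by (rule mult_mat_vec)
      then have "vnorm (A *\<^sub>v v) / vnorm v = vnorm (A *\<^sub>v (?r \<cdot>\<^sub>v v))"
        using pos by (simp add: vnorm_smult norm_divide)
      also have "\<dots> \<le> op_norm A"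
        by (rule le) (use v pos in \<open>auto simp: vnorm_smult norm_divide\<close>)
      finally show ?thesis using pos by (simp add: divide_le_eq)
    qed
  qed
qed

text \<open>A Cholesky-type factorization that stands in for the spectral theorem: a positive
  semidefinite matrix is a sum of rank-one terms \<open>w k\<close> times its conjugate transpose.
  Entries are given by functions on indices, so the induction can remove the last row and column
  without changing matrix dimensions.\<close>

lemma psd_gram_decomposition:
  fixes R :: "nat \<Rightarrow> nat \<Rightarrow> complex"
  assumes "\<And>i j. i < n \<Longrightarrow> j < n \<Longrightarrow> R i j = cnj (R j i)"
    and "\<And>v. 0 \<le> Re (\<Sum>i<n. \<Sum>j<n. cnj (v i) * R i j * v j)"
  shows "\<exists>w. \<forall>i<n. \<forall>j<n. R i j = (\<Sum>k<n. w k i * cnj (w k j))"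
  using assms
proof (induction n arbitrary: R)
  case 0
  then show ?case by simp
next
  case (Suc n)
  note herm = Suc.prems(1) and psd = Suc.prems(2)
  define a where "a = Re (R n n)"
  have Rnn: "R n n = of_real a"
    using herm[of n n] by (simp add: complex_eq_iff a_def)
  have form: "(\<Sum>i<Suc n. \<Sum>j<Suc n. cnj ((v(n := z)) i) * R i j * (v(n := z)) j)
     = (\<Sum>i<n. \<Sum>j<n. cnj (v i) * R i j * v j)
       + (z * cnj (\<Sum>j<n. R n j * v j) + cnj z * (\<Sum>j<n. R n j * v j) + cnj z * z * of_real a)"
    for v :: "nat \<Rightarrow> complex" and z
  proof -
    have "(\<Sum>i<n. cnj (v i) * R i n * z) = z * cnj (\<Sum>j<n. R n j * v j)"
      unfolding cnj_sum sum_distrib_left using herm[of _ n] by (intro sum.cong) auto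
    then show ?thesis
      by (simp add: sum.distrib Rnn sum_distrib_left mult.assoc)
  qed
  have psd': "0 \<le> Re (\<Sum>i<n. \<Sum>j<n. cnj (v i) * R i j * v j)
      + Re (z * cnj (\<Sum>j<n. R n j * v j) + cnj z * (\<Sum>j<n. R n j * v j) + cnj z * z * of_real a)" for v z
    using psd[of "v(n := z)"] unfolding form by simp
  have a0: "0 \<le> a" using psd'[of "\<lambda>_. 0" 1] by simp
  \<comment> \<open>A vanishing diagonal entry forces its column to vanish: otherwise the form at
    \<open>v\<close> with last entry \<open>- of_real r * cnj (R i n)\<close> is affine and
    decreasing in \<open>r\<close>, and \<open>r\<close> is chosen to make it -1.\<close>
  have zero: "R i n = 0" if a: "a = 0" and i: "i < n" for i
  proof (rule ccontr)
    assume nz: "R i n \<noteq> 0"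
    define r where "r = (Re (R i i) + 1) / (2 * (cmod (R i n))\<^sup>2)"
    define v :: "nat \<Rightarrow> complex" where "v = (\<lambda>j. if j = i then 1 else 0)"
    have 1: "(\<Sum>j<n. R n j * v j) = R n i" "(\<Sum>i<n. \<Sum>j<n. cnj (v i) * R i j * v j) = R i i"
      using i by (simp_all add: v_def if_distrib[of "\<lambda>x. _ * x"] if_distrib[of cnj] if_distrib[of "\<lambda>x. x * _"] cong: if_cong)
    have 2: "R n i = cnj (R i n)" using herm[of n i] i by simp
    have "0 \<le> Re (R i i) - 2 * r * (cmod (R i n))\<^sup>2"
      using psd'[of v "- of_real r * cnj (R i n)"] unfolding 1 2 a
      by (simp add: complex_norm_square[symmetric] cmod_power2 power2_eq_square algebra_simps)
    also have "\<dots> = -1" using nz by (simp add: r_def field_simps)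
    finally show False by simp
  qed
  \<comment> \<open>Schur complement; for \<open>a = 0\<close> the quotient is the junk value 0, as it should be.\<close>
  define R' where "R' i j = R i j - R i n * R n j / of_real a" for i j
  have "\<exists>w. \<forall>i<n. \<forall>j<n. R' i j = (\<Sum>k<n. w k i * cnj (w k j))"
  proof (rule Suc.IH)
    show "R' i j = cnj (R' j i)" if "i < n" "j < n" for i j
      using herm[of i j] herm[of i n] herm[of n j] that by (simp add: R'_def mult.commute)
    fix v :: "nat \<Rightarrow> complex"
    define S where "S = (\<Sum>j<n. R n j * v j)"
    have "(\<Sum>i<n. \<Sum>j<n. cnj (v i) * (R i n * R n j / of_real a) * v j) = cnj S * S / of_real a"
    proof -
      have "cnj S = (\<Sum>i<n. cnj (v i) * R i n)"
        unfolding S_def cnj_sum using herm[of _ n] by (intro sum.cong) auto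
      then have "cnj S * S / of_real a = (\<Sum>i<n. \<Sum>j<n. cnj (v i) * R i n * (R n j * v j) / of_real a)"
        by (simp only: S_def sum_product sum_divide_distrib)
      then show ?thesis by (simp add: mult.assoc)
    qed
    then have "(\<Sum>i<n. \<Sum>j<n. cnj (v i) * R' i j * v j)
      = (\<Sum>i<n. \<Sum>j<n. cnj (v i) * R i j * v j) - cnj S * S / of_real a"
      by (simp add: R'_def algebra_simps sum_subtractf)
    \<comment> \<open>The last entry \<open>- (S / of_real a)\<close> minimizes the form when
      \<open>a > 0\<close>, and the minimum is the form of the Schur complement. For
      \<open>a = 0\<close> both sides are 0.\<close>
    moreover have "- (S / of_real a) * cnj S + cnj (- (S / of_real a)) * S
        + cnj (- (S / of_real a)) * (- (S / of_real a)) * of_real a = - (cnj S * S / of_real a)"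
      by (cases "a = 0") (simp_all add: field_simps)
    ultimately show "0 \<le> Re (\<Sum>i<n. \<Sum>j<n. cnj (v i) * R' i j * v j)"
      using psd'[of v "- (S / of_real a)"] unfolding S_def[symmetric] by simp
  qed
  then obtain w where w: "\<And>i j. i < n \<Longrightarrow> j < n \<Longrightarrow> R' i j = (\<Sum>k<n. w k i * cnj (w k j))"
    by blast
  \<comment> \<open>The new vector is the last column divided by \<open>sqrt a\<close>, whose
    rank-one term is exactly what the Schur complement subtracted; the old vectors are padded with a
    zero entry at \<open>n\<close>. For \<open>a = 0\<close> the new vector is zero by division by
    zero.\<close>
  define w' where "w' k i = (if k = n then R i n / of_real (sqrt a) else if i = n then 0 else w k i)" for k i
  have sq: "complex_of_real (sqrt a) * complex_of_real (sqrt a) = of_real a"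
    using a0 by (simp flip: of_real_mult)
  have "R i j = (\<Sum>k<Suc n. w' k i * cnj (w' k j))" if ij: "i < Suc n" "j < Suc n" for i j
  proof -
    have last: "w' n i * cnj (w' n j) = R i n * R n j / of_real a"
      using herm[of n j] ij by (simp add: w'_def sq)
    show ?thesis
    proof (cases "i = n \<or> j = n")
      case True
      have "(\<Sum>k<n. w' k i * cnj (w' k j)) = 0"
        using True by (intro sum.neutral) (auto simp: w'_def)
      moreover have "R i n * R n j / of_real a = R i j"
      proof (cases "a = 0")
        case False
        then show ?thesis using True Rnn by auto
      next
        case True
        then have "R i n = 0" if "i < Suc n" for i
          using that zero[of i] Rnn less_Suc_eq by (cases "i = n") auto
        moreover from this have "R n i = 0" if "i < Suc n" for i
          using that herm[of n i] by simp
        ultimately show ?thesis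
          using \<open>i = n \<or> j = n\<close> ij by auto
      qed
      ultimately show ?thesis using last by simp
    next
      case False
      then have "(\<Sum>k<n. w' k i * cnj (w' k j)) = R' i j"
        using w[of i j] ij by (auto simp: w'_def intro!: sum.cong)
      then show ?thesis using last by (simp add: R'_def)
    qed
  qed
  then show ?case by blast
qed

lemma sum_swap_outer: "(\<Sum>i\<in>A. \<Sum>j\<in>B. \<Sum>k\<in>C. f i j k) = (\<Sum>k\<in>C. \<Sum>j\<in>B. \<Sum>i\<in>A. f i j k)"
proof -
  have "(\<Sum>i\<in>A. \<Sum>j\<in>B. \<Sum>k\<in>C. f i j k) = (\<Sum>j\<in>B. \<Sum>i\<in>A. \<Sum>k\<in>C. f i j k)"
    by (rule sum.swap)
  also have "\<dots> = (\<Sum>j\<in>B. \<Sum>k\<in>C. \<Sum>i\<in>A. f i j k)"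
    by (intro sum.cong refl sum.swap)
  finally show ?thesis by (simp add: sum.swap[of _ C B])
qed

text \<open>Duality of trace norm and operator norm. With \<open>\<rho>\<close> a sum of rank-one
  terms of vectors \<open>u k\<close>, the trace is the sum of the inner products of
  \<open>u k\<close> with \<open>X *\<^sub>v u k\<close>. Cauchy-Schwarz bounds each by
  \<open>c * (vnorm (u k))\<^sup>2\<close>, and the squared norms add up to the trace of
  \<open>\<rho>\<close>, which is 1.\<close>

lemma density_trace_bound:
  assumes rho: "density_matrix N \<rho>" and X: "op_bounded (2 ^ N) X c"
  shows "cmod (mtrace (\<rho> * X)) \<le> c"
proof -
  let ?n = "2 ^ N :: nat"
  have rc: "\<rho> \<in> carrier_mat ?n ?n" and Xc: "X \<in> carrier_mat ?n ?n"
    using rho op_boundedD(1)[OF X] by (auto simp: density_matrix_def is_op_def)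
  have "\<exists>w. \<forall>i<?n. \<forall>j<?n. \<rho> $$ (i, j) = (\<Sum>k<?n. w k i * cnj (w k j))"
  proof (rule psd_gram_decomposition)
    show "\<rho> $$ (i, j) = cnj (\<rho> $$ (j, i))" if "i < ?n" "j < ?n" for i j
    proof -
      have "dim_row \<rho> = ?n" "hermitian \<rho>" using rc rho by (auto simp: density_matrix_def)
      then show ?thesis using that unfolding hermitian_def by metis
    qed
    fix v :: "nat \<Rightarrow> complex"
    show "0 \<le> Re (\<Sum>i<?n. \<Sum>j<?n. cnj (v i) * \<rho> $$ (i, j) * v j)"
    proof -
      have "0 \<le> Re (\<Sum>i<?n. \<Sum>j<?n. cnj (vec_index u i) * \<rho> $$ (i, j) * vec_index u j)"
        if "u \<in> carrier_vec ?n" for u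
        using rho that unfolding density_matrix_def by blast
      from this[of "Matrix.vec ?n v"] show ?thesis by simp
    qed
  qed
  then obtain w where w: "\<And>i j. i < ?n \<Longrightarrow> j < ?n \<Longrightarrow> \<rho> $$ (i, j) = (\<Sum>k<?n. w k i * cnj (w k j))"
    by blast
  define u where "u k = Matrix.vec ?n (w k)" for k
  have uc: "u k \<in> carrier_vec ?n" for k by (simp add: u_def)
  have "mtrace (\<rho> * X) = (\<Sum>i<?n. (\<rho> * X) $$ (i, i))"
    using rc by (simp add: mtrace_def)
  also have "\<dots> = (\<Sum>i<?n. \<Sum>j<?n. \<rho> $$ (i, j) * X $$ (j, i))"
    using index_mult_mat_sum[OF rc Xc] by simp
  also have "\<dots> = (\<Sum>i<?n. \<Sum>j<?n. (\<Sum>k<?n. w k i * cnj (w k j)) * X $$ (j, i))"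
    using w by simp
  also have "\<dots> = (\<Sum>i<?n. \<Sum>j<?n. \<Sum>k<?n. w k i * cnj (w k j) * X $$ (j, i))"
    by (simp add: sum_distrib_right)
  also have "\<dots> = (\<Sum>k<?n. \<Sum>j<?n. \<Sum>i<?n. w k i * cnj (w k j) * X $$ (j, i))"
    by (rule sum_swap_outer)
  also have "\<dots> = (\<Sum>k<?n. \<Sum>j<?n. cnj (vec_index (u k) j) * vec_index (X *\<^sub>v u k) j)"
  proof (intro sum.cong refl)
    fix k j assume "j \<in> {..<?n}"
    then have "vec_index (X *\<^sub>v u k) j = (\<Sum>i<?n. X $$ (j, i) * w k i)"
      by (subst index_mult_mat_vec_sum[OF Xc uc]) (auto simp: u_def)
    moreover have "vec_index (u k) j = w k j"
      using \<open>j \<in> {..<?n}\<close> by (simp add: u_def)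
    ultimately show "(\<Sum>i<?n. w k i * cnj (w k j) * X $$ (j, i))
        = cnj (vec_index (u k) j) * vec_index (X *\<^sub>v u k) j"
      by (simp add: sum_distrib_left mult_ac)
  qed
  finally have tr: "mtrace (\<rho> * X) = \<dots>" .
  have "cmod (mtrace (\<rho> * X)) \<le> (\<Sum>k<?n. c * (vnorm (u k))\<^sup>2)"
    unfolding tr
  proof (rule sum_norm_le)
    fix k assume "k \<in> {..<?n}"
    have "cmod (\<Sum>j<?n. cnj (vec_index (u k) j) * vec_index (X *\<^sub>v u k) j)
      \<le> (\<Sum>j<?n. \<bar>cmod (vec_index (u k) j)\<bar> * \<bar>cmod (vec_index (X *\<^sub>v u k) j)\<bar>)"
      by (rule sum_norm_le) (simp add: norm_mult)
    also have "\<dots> \<le> vnorm (u k) * vnorm (X *\<^sub>v u k)"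
      using L2_set_mult_ineq[of "\<lambda>j. cmod (vec_index (u k) j)" "\<lambda>j. cmod (vec_index (X *\<^sub>v u k) j)" "{..<?n}"] Xc
      by (simp add: vnorm_L2_set u_def)
    also have "\<dots> \<le> vnorm (u k) * (c * vnorm (u k))"
      by (intro mult_left_mono op_boundedD(3)[OF X uc]) simp
    finally show "cmod (\<Sum>j<?n. cnj (vec_index (u k) j) * vec_index (X *\<^sub>v u k) j) \<le> c * (vnorm (u k))\<^sup>2"
      by (simp add: power2_eq_square mult_ac)
  qed
  also have "\<dots> = c * (\<Sum>k<?n. (vnorm (u k))\<^sup>2)" by (simp add: sum_distrib_left)
  also have "(\<Sum>k<?n. (vnorm (u k))\<^sup>2) = Re (mtrace \<rho>)"
  proof -
    have "mtrace \<rho> = (\<Sum>i<?n. \<Sum>k<?n. w k i * cnj (w k i))"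
      using rc w by (simp add: mtrace_def)
    also have "\<dots> = (\<Sum>k<?n. \<Sum>i<?n. of_real ((cmod (w k i))\<^sup>2))"
      by (subst sum.swap) (simp add: complex_norm_square del: of_real_power)
    finally show ?thesis
      by (simp add: vnorm_def u_def sum_nonneg)
  qed
  also have "Re (mtrace \<rho>) = 1" using rho by (simp add: density_matrix_def)
  finally show ?thesis by simp
qed

section \<open>Matrix exponentials\<close>

lemma smult_pow_mat:
  assumes A: "(A :: complex mat) \<in> carrier_mat n n"
  shows "(z \<cdot>\<^sub>m A) ^\<^sub>m k = z ^ k \<cdot>\<^sub>m (A ^\<^sub>m k)"
proof (induction k)
  case 0
  then show ?case using A by (intro eq_matI) auto
next
  case (Suc k)
  have Ak: "A ^\<^sub>m k \<in> carrier_mat n n" by (rule pow_carrier_mat[OF A])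
  have "(z \<cdot>\<^sub>m A) ^\<^sub>m Suc k = (z ^ k \<cdot>\<^sub>m (A ^\<^sub>m k)) * (z \<cdot>\<^sub>m A)" by (simp add: Suc)
  also have "\<dots> = z ^ k \<cdot>\<^sub>m (z \<cdot>\<^sub>m (A ^\<^sub>m k * A))"
    using A Ak mult_smult_assoc_mat[OF Ak, of "z \<cdot>\<^sub>m A" n "z ^ k"] mult_smult_distrib[OF Ak A, of z] by simp
  also have "\<dots> = z ^ Suc k \<cdot>\<^sub>m (A ^\<^sub>m k * A)"
    by (intro eq_matI) (auto simp del: index_mult_mat(1))
  finally show ?case by simp
qed

lemma pow_mat_Suc_left:
  assumes A: "(A :: complex mat) \<in> carrier_mat n n"
  shows "A ^\<^sub>m Suc k = A * A ^\<^sub>m k"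
proof (induction k)
  case 0
  then show ?case using A by simp
next
  case (Suc k)
  have "A ^\<^sub>m Suc (Suc k) = (A * A ^\<^sub>m k) * A" using Suc by simp
  also have "\<dots> = A * (A ^\<^sub>m k * A)"
    by (rule assoc_mult_mat[OF A pow_carrier_mat[OF A] A])
  finally show ?case by simp
qed

text \<open>Each further factor costs at most one row sum of moduli, hence at most the sum over all
  entries. The geometric growth makes the exponential series converge entrywise.\<close>

lemma pow_mat_entry_bound:
  assumes A: "(A :: complex mat) \<in> carrier_mat n n" and "i < n" "j < n"
  shows "cmod ((A ^\<^sub>m k) $$ (i, j)) \<le> (\<Sum>i<n. \<Sum>j<n. cmod (A $$ (i, j))) ^ k"
  using assms(2,3)
proof (induction k arbitrary: i j)
  case 0
  then show ?case using A by simp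
next
  case (Suc k)
  define C where "C = (\<Sum>i<n. \<Sum>j<n. cmod (A $$ (i, j)))"
  have C0: "0 \<le> C" unfolding C_def by (intro sum_nonneg) auto
  have "cmod ((A ^\<^sub>m Suc k) $$ (i, j)) = cmod (\<Sum>l<n. A $$ (i, l) * (A ^\<^sub>m k) $$ (l, j))"
    unfolding pow_mat_Suc_left[OF A] using index_mult_mat_sum[OF A pow_carrier_mat[OF A]] Suc.prems by simp
  also have "\<dots> \<le> (\<Sum>l<n. cmod (A $$ (i, l)) * C ^ k)"
    using Suc by (intro sum_norm_le) (auto simp: norm_mult C_def intro!: mult_left_mono)
  also have "\<dots> = (\<Sum>l<n. cmod (A $$ (i, l))) * C ^ k" by (simp add: sum_distrib_right)
  also have "\<dots> \<le> C * C ^ k"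
    unfolding C_def using Suc.prems C0
    by (intro mult_right_mono member_le_sum[of i "{..<n}" "\<lambda>i. \<Sum>l<n. cmod (A $$ (i, l))"])
      (auto intro!: sum_nonneg zero_le_power)
  finally show ?case by (simp add: C_def)
qed

lemma summable_mat_exp:
  assumes A: "(A :: complex mat) \<in> carrier_mat n n" and "i < n" "j < n"
  shows "summable (\<lambda>k. (A ^\<^sub>m k) $$ (i, j) / fact k * z ^ k)"
proof (rule summable_comparison_test')
  define C where "C = (\<Sum>i<n. \<Sum>j<n. cmod (A $$ (i, j)))"
  show "summable (\<lambda>k. inverse (fact k) * (C * cmod z) ^ k)" by (rule summable_exp)
  fix k :: nat
  have "norm ((A ^\<^sub>m k) $$ (i, j) / fact k * z ^ k) = cmod ((A ^\<^sub>m k) $$ (i, j)) * (cmod z ^ k / fact k)"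
    by (simp add: norm_mult norm_divide norm_power)
  also have "\<dots> \<le> C ^ k * (cmod z ^ k / fact k)"
    unfolding C_def by (intro mult_right_mono pow_mat_entry_bound[OF assms]) simp
  finally show "norm ((A ^\<^sub>m k) $$ (i, j) / fact k * z ^ k) \<le> inverse (fact k) * (C * cmod z) ^ k"
    by (simp add: power_mult_distrib divide_inverse mult_ac)
qed

lemma mat_exp_carrier: "A \<in> carrier_mat n n \<Longrightarrow> mat_exp A \<in> carrier_mat n n"
  by (simp add: mat_exp_def)

text \<open>Along the complex line through \<open>A\<close> each entry of the exponential is a
  scalar power series in \<open>z\<close>, so calculus on matrices reduces to termwise
  differentiation.\<close>

lemma mat_exp_smult_index:
  assumes A: "A \<in> carrier_mat n n" and ij: "i < n" "j < n"
  shows "mat_exp (z \<cdot>\<^sub>m A) $$ (i, j) = (\<Sum>k. (A ^\<^sub>m k) $$ (i, j) / fact k * z ^ k)"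
proof -
  have "((z \<cdot>\<^sub>m A) ^\<^sub>m k) $$ (i, j) = z ^ k * (A ^\<^sub>m k) $$ (i, j)" for k
    using smult_pow_mat[OF A, of z k] ij A by simp
  then show ?thesis using A ij by (simp add: mat_exp_def mult.commute)
qed

lemma mat_exp_smult_zero:
  assumes A: "A \<in> carrier_mat n n"
  shows "mat_exp (0 \<cdot>\<^sub>m A) = 1\<^sub>m n"
proof (rule eq_matI)
  show "mat_exp (0 \<cdot>\<^sub>m A) $$ (i, j) = 1\<^sub>m n $$ (i, j)" if "i < dim_row (1\<^sub>m n)" "j < dim_col (1\<^sub>m n)" for i j
    using that A mat_exp_smult_index[OF A, of i j 0] powser_zero[of "\<lambda>k. (A ^\<^sub>m k) $$ (i, j) / fact k"] by simp
qed (use A in \<open>auto simp: mat_exp_def\<close>)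

text \<open>The differentiated series has coefficients \<open>A ^\<^sub>m Suc k\<close> over
  \<open>fact k\<close>. Splitting off one factor on the left gives the derivative; splitting it off
  on the right gives the same series and hence commutation.\<close>

lemma DERIV_mat_exp:
  assumes A: "A \<in> carrier_mat n n" and ij: "i < n" "j < n"
  shows "((\<lambda>z. mat_exp (z \<cdot>\<^sub>m A) $$ (i, j)) has_field_derivative (A * mat_exp (z \<cdot>\<^sub>m A)) $$ (i, j)) (at z)"
    and "(mat_exp (z \<cdot>\<^sub>m A) * A) $$ (i, j) = (A * mat_exp (z \<cdot>\<^sub>m A)) $$ (i, j)"
proof -
  define c where "c i j k = (A ^\<^sub>m k) $$ (i, j) / fact k" for i j k
  have E: "mat_exp (z \<cdot>\<^sub>m A) \<in> carrier_mat n n" using A by (intro mat_exp_carrier) simp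
  have c: "summable (\<lambda>k. c i j k * z ^ k)" "mat_exp (z \<cdot>\<^sub>m A) $$ (i, j) = (\<Sum>k. c i j k * z ^ k)"
    if "i < n" "j < n" for i j z
    unfolding c_def using summable_mat_exp[OF A that] mat_exp_smult_index[OF A that] by simp_all
  have d: "diffs (c i j) k = (A ^\<^sub>m Suc k) $$ (i, j) / fact k" for k
    by (simp add: diffs_def c_def del: pow_mat.simps of_nat_Suc)
  have d1: "diffs (c i j) k * z ^ k = (\<Sum>l<n. A $$ (i, l) * (c l j k * z ^ k))" for k
    unfolding d pow_mat_Suc_left[OF A] index_mult_mat_sum[OF A pow_carrier_mat[OF A] ij]
    by (simp add: c_def sum_divide_distrib sum_distrib_left sum_distrib_right mult_ac)
  have d2: "diffs (c i j) k * z ^ k = (\<Sum>l<n. (c i l k * z ^ k) * A $$ (l, j))" for k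
    unfolding d pow_mat.simps index_mult_mat_sum[OF pow_carrier_mat[OF A] A ij]
    by (simp add: c_def sum_divide_distrib sum_distrib_left sum_distrib_right mult_ac)
  have "(\<Sum>k. diffs (c i j) k * z ^ k) = (\<Sum>l<n. \<Sum>k. A $$ (i, l) * (c l j k * z ^ k))"
    unfolding d1 using c(1) ij by (intro suminf_sum summable_mult) auto
  also have "\<dots> = (A * mat_exp (z \<cdot>\<^sub>m A)) $$ (i, j)"
    unfolding index_mult_mat_sum[OF A E ij] using c ij by (intro sum.cong refl) (simp add: suminf_mult)
  finally have 1: "(\<Sum>k. diffs (c i j) k * z ^ k) = (A * mat_exp (z \<cdot>\<^sub>m A)) $$ (i, j)" .
  have "(\<Sum>k. diffs (c i j) k * z ^ k) = (\<Sum>l<n. \<Sum>k. (c i l k * z ^ k) * A $$ (l, j))"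
    unfolding d2 using c(1) ij by (intro suminf_sum summable_mult2) auto
  also have "\<dots> = (mat_exp (z \<cdot>\<^sub>m A) * A) $$ (i, j)"
    unfolding index_mult_mat_sum[OF E A ij] using c ij by (intro sum.cong refl) (simp add: suminf_mult2)
  finally show "(mat_exp (z \<cdot>\<^sub>m A) * A) $$ (i, j) = (A * mat_exp (z \<cdot>\<^sub>m A)) $$ (i, j)"
    using 1 by simp
  have "((\<lambda>z. \<Sum>k. c i j k * z ^ k) has_field_derivative (\<Sum>k. diffs (c i j) k * z ^ k)) (at z)"
    by (rule termdiffs_strong_converges_everywhere) (use c ij in auto)
  then show "((\<lambda>z. mat_exp (z \<cdot>\<^sub>m A) $$ (i, j)) has_field_derivative (A * mat_exp (z \<cdot>\<^sub>m A)) $$ (i, j)) (at z)"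
    unfolding 1 c(2)[OF ij] .
qed

lemma mat_exp_commute:
  assumes A: "A \<in> carrier_mat n n"
  shows "mat_exp (z \<cdot>\<^sub>m A) * A = A * mat_exp (z \<cdot>\<^sub>m A)"
  using A mat_exp_carrier[of "z \<cdot>\<^sub>m A" n] DERIV_mat_exp(2)[OF A]
  by (intro eq_matI) (auto simp del: index_mult_mat(1))

text \<open>The matrix type does not fix a dimension and so carries no normed space structure;
  derivatives are taken entrywise. \<open>F x\<close> has the right dimension for every
  \<open>x\<close>, because the entries of a product are rewritten as sums for the whole
  curve.\<close>

definition has_mat_derivative :: "nat \<Rightarrow> (real \<Rightarrow> complex mat) \<Rightarrow> complex mat \<Rightarrow> real \<Rightarrow> bool" where
  "has_mat_derivative n F F' s \<longleftrightarrow> (\<forall>x. F x \<in> carrier_mat n n) \<and> F' \<in> carrier_mat n n \<and>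
     (\<forall>i<n. \<forall>j<n. ((\<lambda>x. F x $$ (i, j)) has_vector_derivative F' $$ (i, j)) (at s))"

lemma has_mat_derivativeD:
  assumes "has_mat_derivative n F F' s"
  shows "F x \<in> carrier_mat n n" "F' \<in> carrier_mat n n"
    "i < n \<Longrightarrow> j < n \<Longrightarrow> ((\<lambda>x. F x $$ (i, j)) has_vector_derivative F' $$ (i, j)) (at s)"
  using assms by (auto simp: has_mat_derivative_def)

lemma has_mat_derivative_const: "X \<in> carrier_mat n n \<Longrightarrow> has_mat_derivative n (\<lambda>_. X) (0\<^sub>m n n) s"
  by (simp add: has_mat_derivative_def)

lemma has_mat_derivative_mult:
  assumes F: "has_mat_derivative n F F' s" and G: "has_mat_derivative n G G' s"
  shows "has_mat_derivative n (\<lambda>x. F x * G x) (F' * G s + F s * G') s"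
  unfolding has_mat_derivative_def
proof (intro conjI allI impI)
  note cF = has_mat_derivativeD(1,2)[OF F] and cG = has_mat_derivativeD(1,2)[OF G]
  show "F x * G x \<in> carrier_mat n n" for x by (rule mult_carrier_mat[OF cF(1) cG(1)])
  show "F' * G s + F s * G' \<in> carrier_mat n n"
    by (intro add_carrier_mat mult_carrier_mat[OF cF(1) cG(2)])
  fix i j assume ij: "i < n" "j < n"
  have eq: "(F' * G s + F s * G') $$ (i, j)
     = (\<Sum>l<n. F s $$ (i, l) * G' $$ (l, j) + F' $$ (i, l) * G s $$ (l, j))"
    using ij cF(2) cG(2) cF(1)[of s] cG(1)[of s] index_mult_mat_sum[OF cF(2) cG(1) ij] index_mult_mat_sum[OF cF(1) cG(2) ij]
    by (simp add: sum.distrib del: index_mult_mat(1)) 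
  have "((\<lambda>x. \<Sum>l<n. F x $$ (i, l) * G x $$ (l, j)) has_vector_derivative
      (\<Sum>l<n. F s $$ (i, l) * G' $$ (l, j) + F' $$ (i, l) * G s $$ (l, j))) (at s)"
    using ij by (intro has_vector_derivative_sum has_vector_derivative_mult
        has_mat_derivativeD(3)[OF F] has_mat_derivativeD(3)[OF G]) auto
  then show "((\<lambda>x. (F x * G x) $$ (i, j)) has_vector_derivative (F' * G s + F s * G') $$ (i, j)) (at s)"
    unfolding eq using index_mult_mat_sum[OF cF(1) cG(1) ij] by simp
qed

lemma has_mat_derivative_mat_exp:
  assumes A: "A \<in> carrier_mat n n" and g: "(g has_vector_derivative g') (at s)"
  shows "has_mat_derivative n (\<lambda>x. mat_exp (g x \<cdot>\<^sub>m A)) (g' \<cdot>\<^sub>m (A * mat_exp (g s \<cdot>\<^sub>m A))) s"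
  unfolding has_mat_derivative_def
proof (intro conjI allI impI)
  show E: "mat_exp (g x \<cdot>\<^sub>m A) \<in> carrier_mat n n" for x using A by (intro mat_exp_carrier) simp
  show "g' \<cdot>\<^sub>m (A * mat_exp (g s \<cdot>\<^sub>m A)) \<in> carrier_mat n n" using mult_carrier_mat[OF A E] by simp
  fix i j assume ij: "i < n" "j < n"
  have "((\<lambda>x. mat_exp (g x \<cdot>\<^sub>m A) $$ (i, j)) has_vector_derivative g' * (A * mat_exp (g s \<cdot>\<^sub>m A)) $$ (i, j)) (at s)"
    using field_vector_diff_chain_at[OF g DERIV_mat_exp(1)[OF A ij]] by (simp add: o_def)
  moreover have "(g' \<cdot>\<^sub>m (A * mat_exp (g s \<cdot>\<^sub>m A))) $$ (i, j) = g' * (A * mat_exp (g s \<cdot>\<^sub>m A)) $$ (i, j)"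
    using ij A E[of s] by (simp del: index_mult_mat(1))
  ultimately show "((\<lambda>x. mat_exp (g x \<cdot>\<^sub>m A) $$ (i, j)) has_vector_derivative
      (g' \<cdot>\<^sub>m (A * mat_exp (g s \<cdot>\<^sub>m A))) $$ (i, j)) (at s)"
    by simp
qed

section \<open>Unitarity of the evolution\<close>

lemma hermitianD:
  "hermitian A \<Longrightarrow> A \<in> carrier_mat n n \<Longrightarrow> i < n \<Longrightarrow> j < n \<Longrightarrow> A $$ (i, j) = cnj (A $$ (j, i))"
  unfolding hermitian_def by (metis carrier_matD(1))

text \<open>The orbit \<open>u\<close> solves the Schroedinger equation with generator
  \<open>A\<close>, and a Hermitian generator conserves the squared norm \<open>q\<close>. This
  avoids adjoints and inverses of the exponential.\<close>

lemma mat_exp_isometry: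
  assumes A: "A \<in> carrier_mat n n" and herm: "hermitian A" and v: "v \<in> carrier_vec n"
  shows "vnorm (mat_exp ((\<i> * of_real t) \<cdot>\<^sub>m A) *\<^sub>v v) = vnorm v"
proof -
  define E where "E s = mat_exp ((\<i> * of_real s) \<cdot>\<^sub>m A)" for s
  have E: "E s \<in> carrier_mat n n" for s unfolding E_def using A by (intro mat_exp_carrier) simp
  define u where "u s i = vec_index (E s *\<^sub>v v) i" for s i
  have u: "u s i = (\<Sum>j<n. E s $$ (i, j) * vec_index v j)" if "i < n" for s i
    unfolding u_def by (rule index_mult_mat_vec_sum[OF E v that])
  have dE: "has_mat_derivative n E (\<i> \<cdot>\<^sub>m (A * E s)) s" for s
    unfolding E_def
    by (rule has_mat_derivative_mat_exp[OF A]) (auto intro!: derivative_eq_intros simp: has_vector_derivative_def scaleR_conv_of_real)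
  have du: "((\<lambda>s. u s i) has_vector_derivative \<i> * (\<Sum>l<n. A $$ (i, l) * u s l)) (at s)" if i: "i < n" for i s
  proof -
    have "((\<lambda>s. \<Sum>j<n. E s $$ (i, j) * vec_index v j) has_vector_derivative
       (\<Sum>j<n. (\<i> \<cdot>\<^sub>m (A * E s)) $$ (i, j) * vec_index v j)) (at s)"
      using i by (intro has_vector_derivative_sum has_vector_derivative_mult_left has_mat_derivativeD(3)[OF dE]) auto
    moreover have "(\<Sum>j<n. (\<i> \<cdot>\<^sub>m (A * E s)) $$ (i, j) * vec_index v j) = \<i> * (\<Sum>l<n. A $$ (i, l) * u s l)"
    proof -
      have "(\<Sum>j<n. (\<i> \<cdot>\<^sub>m (A * E s)) $$ (i, j) * vec_index v j)
         = (\<Sum>j<n. \<Sum>l<n. \<i> * (A $$ (i, l) * E s $$ (l, j) * vec_index v j))"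
      proof (rule sum.cong[OF refl])
        fix j assume "j \<in> {..<n}"
        then have "(\<i> \<cdot>\<^sub>m (A * E s)) $$ (i, j) = \<i> * (\<Sum>l<n. A $$ (i, l) * E s $$ (l, j))"
          using i A E[of s] index_mult_mat_sum[OF A E i, of j] by (simp del: index_mult_mat(1))
        then show "(\<i> \<cdot>\<^sub>m (A * E s)) $$ (i, j) * vec_index v j
            = (\<Sum>l<n. \<i> * (A $$ (i, l) * E s $$ (l, j) * vec_index v j))"
          by (simp add: sum_distrib_left sum_distrib_right mult.assoc)
      qed
      also have "\<dots> = (\<Sum>l<n. \<Sum>j<n. \<i> * (A $$ (i, l) * E s $$ (l, j) * vec_index v j))"
        by (rule sum.swap)
      also have "\<dots> = \<i> * (\<Sum>l<n. A $$ (i, l) * u s l)"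
        by (simp add: u sum_distrib_left mult.assoc)
      finally show ?thesis .
    qed
    ultimately show ?thesis using u[OF i] by simp
  qed
  define q where "q s = (\<Sum>i<n. u s i * cnj (u s i))" for s
  have dq: "(q has_vector_derivative 0) (at s)" for s
  proof -
    let ?d = "\<lambda>i. \<i> * (\<Sum>l<n. A $$ (i, l) * u s l)"
    have "(q has_vector_derivative (\<Sum>i<n. u s i * cnj (?d i) + ?d i * cnj (u s i))) (at s)"
      unfolding q_def
      by (intro has_vector_derivative_sum has_vector_derivative_mult has_vector_derivative_cnj du) auto
    \<comment> \<open>Hermiticity moves the conjugate off \<open>A\<close>; exchanging the summation
      indices then turns one half of the product rule into the negative of the other, since
      \<open>cnj \<i> = - \<i>\<close>.\<close>
    moreover have "(\<Sum>i<n. u s i * cnj (?d i) + ?d i * cnj (u s i)) = 0"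
    proof -
      have "(\<Sum>i<n. u s i * cnj (?d i)) = (\<Sum>i<n. \<Sum>l<n. - \<i> * (A $$ (l, i) * u s i * cnj (u s l)))"
      proof (rule sum.cong[OF refl])
        fix i assume i: "i \<in> {..<n}"
        have h: "cnj (A $$ (i, l)) = A $$ (l, i)" if "l < n" for l
          using hermitianD[OF herm A that, of i] i by simp
        show "u s i * cnj (?d i) = (\<Sum>l<n. - \<i> * (A $$ (l, i) * u s i * cnj (u s l)))"
          by (simp add: h sum_distrib_left mult_ac sum_negf)
      qed
      also have "\<dots> = (\<Sum>l<n. \<Sum>i<n. - \<i> * (A $$ (l, i) * u s i * cnj (u s l)))"
        by (rule sum.swap)
      also have "\<dots> = - (\<Sum>i<n. ?d i * cnj (u s i))"
        by (simp add: sum_negf sum_distrib_left sum_distrib_right mult_ac)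
      finally show ?thesis unfolding sum.distrib by simp
    qed
    ultimately show ?thesis by simp
  qed
  have "q t = q 0"
  proof -
    obtain c where "\<And>x. x \<in> UNIV \<Longrightarrow> q x = c"
      using has_vector_derivative_zero_constant[of UNIV q] dq by auto
    then show ?thesis by simp
  qed
  moreover have "q s = of_real ((vnorm (E s *\<^sub>v v))\<^sup>2)" for s
    using E[of s] by (simp add: q_def vnorm_def u_def sum_nonneg complex_norm_square del: of_real_power)
  ultimately have "(vnorm (E t *\<^sub>v v))\<^sup>2 = (vnorm (E 0 *\<^sub>v v))\<^sup>2"
    by (simp del: of_real_power)
  also have "E 0 *\<^sub>v v = v"
    using mat_exp_smult_zero[OF A] v by (simp add: E_def)
  finally show ?thesis by (simp add: E_def)
qed

lemma op_bounded_mat_exp: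
  assumes A: "A \<in> carrier_mat n n" and herm: "hermitian A"
  shows "op_bounded n (mat_exp ((\<i> * of_real t) \<cdot>\<^sub>m A)) 1"
  unfolding op_bounded_def
proof (intro conjI ballI)
  show "mat_exp ((\<i> * of_real t) \<cdot>\<^sub>m A) \<in> carrier_mat n n"
    by (intro mat_exp_carrier smult_carrier_mat A)
  show "vnorm (mat_exp ((\<i> * of_real t) \<cdot>\<^sub>m A) *\<^sub>v v) \<le> 1 * vnorm v" if "v \<in> carrier_vec n" for v
    using mat_exp_isometry[OF A herm that, of t] by (simp only: mult_1 order_refl)
qed simp

lemma op_bounded_heis:
  assumes A: "A \<in> carrier_mat n n" and herm: "hermitian A" and X: "op_bounded n X c"
  shows "op_bounded n (heis A t X) c"
proof -
  have "op_bounded n (heis A t X) (1 * c * 1)"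
    unfolding heis_def
    using op_bounded_mult[OF op_bounded_mult[OF op_bounded_mat_exp[OF A herm, of t] X]
        op_bounded_mat_exp[OF A herm, of "-t"]]
    by (simp only: of_real_minus mult_minus_left mult_minus_right)
  then show ?thesis by simp
qed

section \<open>Perturbation of the Heisenberg evolution\<close>

lemma heis_carrier:
  "A \<in> carrier_mat n n \<Longrightarrow> X \<in> carrier_mat n n \<Longrightarrow> heis A t X \<in> carrier_mat n n"
  unfolding heis_def by (intro mult_carrier_mat[of _ n n] mat_exp_carrier smult_carrier_mat)

text \<open>The premises of these laws mention dimensions that do not occur in the equations, so
  rewriting could not infer them; all are set to one \<open>n\<close>.\<close>

lemmas square_mat_simps =
  assoc_mult_mat[of _ n n _ n _ n] add_mult_distrib_mat[of _ n n _ _ n] mult_add_distrib_mat[of _ n n _ n]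
  minus_mult_distrib_mat[of _ n n _ _ n] mult_minus_distrib_mat[of _ n n _ n]
  mult_smult_distrib[of _ n n _ n] mult_smult_assoc_mat[of _ n n _ n]
  mult_carrier_mat[of _ n n _ n] for n

text \<open>The remaining time \<open>t - x\<close> decreases, which gives the commutator its minus
  sign. Since \<open>A\<close> commutes with its own exponential, the commutator can be placed
  inside the conjugation, next to \<open>Y s\<close>.\<close>

lemma has_mat_derivative_heis:
  assumes A: "A \<in> carrier_mat n n" and Y: "has_mat_derivative n Y Y' s"
  shows "has_mat_derivative n (\<lambda>x. heis A (t - x) (Y x))
    (heis A (t - s) (Y' - \<i> \<cdot>\<^sub>m (A * Y s - Y s * A))) s"
proof -
  define P where "P x = mat_exp ((\<i> * of_real (t - x)) \<cdot>\<^sub>m A)" for x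
  define Q where "Q x = mat_exp ((- \<i> * of_real (t - x)) \<cdot>\<^sub>m A)" for x
  have c: "P x \<in> carrier_mat n n" "Q x \<in> carrier_mat n n" for x
    unfolding P_def Q_def by (intro mat_exp_carrier smult_carrier_mat A)+
  note cY = has_mat_derivativeD(1,2)[OF Y]
  have dP: "has_mat_derivative n P ((- \<i>) \<cdot>\<^sub>m (A * P s)) s"
    unfolding P_def
    by (rule has_mat_derivative_mat_exp[OF A]) (auto intro!: derivative_eq_intros)
  have dQ: "has_mat_derivative n Q (\<i> \<cdot>\<^sub>m (A * Q s)) s"
    unfolding Q_def
    by (rule has_mat_derivative_mat_exp[OF A]) (auto intro!: derivative_eq_intros)
  have com: "A * P s = P s * A"
    unfolding P_def by (rule mat_exp_commute[OF A, symmetric])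
  have "has_mat_derivative n (\<lambda>x. P x * Y x * Q x)
      (((- \<i>) \<cdot>\<^sub>m (P s * A) * Y s + P s * Y') * Q s + P s * Y s * (\<i> \<cdot>\<^sub>m (A * Q s))) s"
    using has_mat_derivative_mult[OF has_mat_derivative_mult[OF dP Y] dQ] unfolding com .
  also have "((- \<i>) \<cdot>\<^sub>m (P s * A) * Y s + P s * Y') * Q s + P s * Y s * (\<i> \<cdot>\<^sub>m (A * Q s))
      = P s * (Y' - \<i> \<cdot>\<^sub>m (A * Y s - Y s * A)) * Q s"
    using c[of s] cY(2) cY(1)[of s] A
    by (simp add: square_mat_simps[where n=n] minus_carrier_mat) (rule eq_matI; simp add: algebra_simps del: index_mult_mat(1))
  finally show ?thesis unfolding heis_def P_def Q_def .
qed

text \<open>The Heisenberg equation of motion. The generator stays outside the evolved observable,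
  so that in the interpolation below both commutators act on the same operator.\<close>

lemma has_mat_derivative_heis_const:
  assumes B: "B \<in> carrier_mat n n" and X: "X \<in> carrier_mat n n"
  shows "has_mat_derivative n (\<lambda>x. heis B x X) (\<i> \<cdot>\<^sub>m (B * heis B s X - heis B s X * B)) s"
proof -
  define P where "P x = mat_exp ((\<i> * of_real x) \<cdot>\<^sub>m B)" for x
  define Q where "Q x = mat_exp ((- \<i> * of_real x) \<cdot>\<^sub>m B)" for x
  have c: "P x \<in> carrier_mat n n" "Q x \<in> carrier_mat n n" for x
    unfolding P_def Q_def by (intro mat_exp_carrier smult_carrier_mat B)+
  have dP: "has_mat_derivative n P (\<i> \<cdot>\<^sub>m (B * P s)) s"
    unfolding P_def
    by (rule has_mat_derivative_mat_exp[OF B]) (auto intro!: derivative_eq_intros)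
  have dQ: "has_mat_derivative n Q ((- \<i>) \<cdot>\<^sub>m (B * Q s)) s"
    unfolding Q_def
    by (rule has_mat_derivative_mat_exp[OF B]) (auto intro!: derivative_eq_intros)
  have com: "B * Q s = Q s * B"
    unfolding Q_def by (rule mat_exp_commute[OF B, symmetric])
  have "has_mat_derivative n (\<lambda>x. P x * X * Q x)
      ((\<i> \<cdot>\<^sub>m (B * P s) * X + P s * 0\<^sub>m n n) * Q s + P s * X * ((- \<i>) \<cdot>\<^sub>m (Q s * B))) s"
    using has_mat_derivative_mult[OF has_mat_derivative_mult[OF dP has_mat_derivative_const[OF X]] dQ]
    unfolding com .
  also have "(\<i> \<cdot>\<^sub>m (B * P s) * X + P s * 0\<^sub>m n n) * Q s + P s * X * ((- \<i>) \<cdot>\<^sub>m (Q s * B))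
      = \<i> \<cdot>\<^sub>m (B * (P s * X * Q s) - (P s * X * Q s) * B)"
    using c[of s] X B
    by (simp add: square_mat_simps[where n=n] minus_carrier_mat) (rule eq_matI; simp add: algebra_simps del: index_mult_mat(1))
  finally show ?thesis unfolding heis_def P_def Q_def .
qed

lemma has_vector_derivative_mtrace:
  assumes F: "has_mat_derivative n F F' s"
  shows "((\<lambda>x. mtrace (F x)) has_vector_derivative mtrace F') (at s)"
proof -
  have "((\<lambda>x. \<Sum>i<n. F x $$ (i, i)) has_vector_derivative (\<Sum>i<n. F' $$ (i, i))) (at s)"
    by (intro has_vector_derivative_sum has_mat_derivativeD(3)[OF F]) auto
  then show ?thesis
    using carrier_matD[OF has_mat_derivativeD(1)[OF F]] carrier_matD[OF has_mat_derivativeD(2)[OF F]]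
    by (simp add: mtrace_def)
qed

text \<open>In the derivative of the interpolation only the commutator of \<open>B - A\<close> with
  the evolved observable survives, so the size of \<open>A\<close> and \<open>B\<close> does not
  enter. Its norm is at most \<open>2 * c * d\<close>, the outer evolution preserves this, and the
  mean value inequality supplies the factor \<open>t\<close>.\<close>

lemma trace_heis_diff_bound:
  fixes N :: nat
  defines "n \<equiv> 2 ^ N"
  assumes rho: "density_matrix N \<rho>"
    and A: "A \<in> carrier_mat n n" "hermitian A" and B: "B \<in> carrier_mat n n" "hermitian B"
    and X: "op_bounded n X c" and D: "op_bounded n (B - A) d" and t: "0 \<le> t"
  shows "cmod (mtrace (\<rho> * heis B t X) - mtrace (\<rho> * heis A t X)) \<le> 2 * c * d * t"
proof -
  have rc: "\<rho> \<in> carrier_mat n n"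
    using rho by (simp add: density_matrix_def is_op_def n_def)
  have Xc: "X \<in> carrier_mat n n" by (rule op_boundedD(1)[OF X])
  \<comment> \<open>Duhamel: interpolate between the two evolutions, using \<open>B\<close> up to time \<open>s\<close> and \<open>A\<close> afterwards.\<close>
  define Y where "Y s = heis B s X" for s
  have Yb: "op_bounded n (Y s) c" for s unfolding Y_def by (rule op_bounded_heis[OF B X])
  define Z where "Z s = \<i> \<cdot>\<^sub>m (B * Y s - Y s * B) - \<i> \<cdot>\<^sub>m (A * Y s - Y s * A)" for s
  have Zb: "op_bounded n (Z s) (2 * c * d)" for s
  proof -
    have "Z s = \<i> \<cdot>\<^sub>m ((B - A) * Y s - Y s * (B - A))"
      unfolding Z_def using A(1) B(1) op_boundedD(1)[OF Yb[of s]]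
      by (simp add: square_mat_simps[where n=n] minus_carrier_mat) (rule eq_matI; simp add: algebra_simps del: index_mult_mat(1))
    then show ?thesis
      using op_bounded_smult[OF op_bounded_diff[OF op_bounded_mult[OF D Yb] op_bounded_mult[OF Yb D]], of \<i> s s]
      by (simp add: algebra_simps)
  qed
  define \<Phi> where "\<Phi> s = mtrace (\<rho> * heis A (t - s) (Y s))" for s
  define \<Phi>' where "\<Phi>' s = mtrace (\<rho> * heis A (t - s) (Z s))" for s
  have d: "(\<Phi> has_vector_derivative \<Phi>' s) (at s)" for s
  proof -
    have dY: "has_mat_derivative n Y (\<i> \<cdot>\<^sub>m (B * Y s - Y s * B)) s"
      unfolding Y_def by (rule has_mat_derivative_heis_const[OF B(1) Xc])
    have cZ: "heis A (t - s) (Z s) \<in> carrier_mat n n"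
      by (rule heis_carrier[OF A(1) op_boundedD(1)[OF Zb]])
    have cY: "heis A (t - s) (Y s) \<in> carrier_mat n n"
      by (rule heis_carrier[OF A(1) op_boundedD(1)[OF Yb]])
    have "has_mat_derivative n (\<lambda>x. \<rho> * heis A (t - x) (Y x))
        (0\<^sub>m n n * heis A (t - s) (Y s) + \<rho> * heis A (t - s) (Z s)) s"
      unfolding Z_def
      by (rule has_mat_derivative_mult[OF has_mat_derivative_const[OF rc] has_mat_derivative_heis[OF A(1) dY]])
    also have "0\<^sub>m n n * heis A (t - s) (Y s) + \<rho> * heis A (t - s) (Z s) = \<rho> * heis A (t - s) (Z s)"
      using left_mult_zero_mat[OF cY] left_add_zero_mat[OF mult_carrier_mat[OF rc cZ]] by simp
    finally show ?thesis
      unfolding \<Phi>_def \<Phi>'_def by (rule has_vector_derivative_mtrace)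
  qed
  have bound: "cmod (\<Phi>' s) \<le> 2 * c * d" for s
    unfolding \<Phi>'_def
    using density_trace_bound[OF rho] op_bounded_heis[OF A Zb] unfolding n_def by blast
  have "norm (\<Phi> t - \<Phi> 0) \<le> 2 * c * d * norm (t - 0)"
  proof (rule differentiable_bound[of UNIV])
    show "(\<Phi> has_derivative (\<lambda>h. h *\<^sub>R \<Phi>' s)) (at s within UNIV)" for s
      using d[of s] by (simp add: has_vector_derivative_def)
    show "onorm (\<lambda>h. h *\<^sub>R \<Phi>' s) \<le> 2 * c * d" for s
    proof (rule onorm_bound)
      show "0 \<le> 2 * c * d" using op_boundedD(2)[OF X] op_boundedD(2)[OF D] by simp
      show "norm (h *\<^sub>R \<Phi>' s) \<le> 2 * c * d * norm h" for h
        using mult_left_mono[OF bound[of s], of "\<bar>h\<bar>"] by (simp add: mult_ac)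
    qed
  qed auto
  \<comment> \<open>Identifies the endpoints: \<open>\<Phi> t\<close> is the trace for the evolution
    under \<open>B\<close>, and \<open>\<Phi> 0\<close> the one under \<open>A\<close>.\<close>
  moreover have heis0: "heis C 0 W = W" if "C \<in> carrier_mat n n" "W \<in> carrier_mat n n" for C W
    using mat_exp_smult_zero[OF that(1)] that(2) by (simp add: heis_def)
  ultimately show ?thesis
    using t heis0[OF B(1) Xc] heis0[OF A(1) op_boundedD(1)[OF Yb[of t]]]
    by (simp add: \<Phi>_def Y_def)
qed

section \<open>The perturbed Hamiltonian as a function of the random couplings\<close>

lemma pert_ham_carrier: "pert_ham N H M g V \<in> carrier_mat (2 ^ N) (2 ^ N)"
  by (simp add: pert_ham_def)

text \<open>The target Hamiltonian cancels and each \<open>V l\<close> contributes at most its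
  change of coupling; this is the source of the l1 distance in \<open>l1_lipschitz\<close>.\<close>

lemma pert_ham_diff_bounded:
  assumes "\<And>l. l < M \<Longrightarrow> op_bounded (2 ^ N) (V l) 1"
  shows "op_bounded (2 ^ N) (pert_ham N H M g V - pert_ham N H M g' V) (\<Sum>l<M. \<bar>g l - g' l\<bar>)"
  using assms
proof (induction M)
  case 0
  have "pert_ham N H 0 g V - pert_ham N H 0 g' V = 0\<^sub>m (2 ^ N) (2 ^ N)"
    by (rule eq_matI) (auto simp: pert_ham_def)
  then show ?case by (simp add: op_bounded_zero)
next
  case (Suc M)
  have "op_bounded (2 ^ N) ((pert_ham N H M g V - pert_ham N H M g' V) + of_real (g M - g' M) \<cdot>\<^sub>m V M)
     ((\<Sum>l<M. \<bar>g l - g' l\<bar>) + cmod (of_real (g M - g' M)) * 1)"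
    by (intro op_bounded_add op_bounded_smult Suc) auto
  moreover have "(pert_ham N H M g V - pert_ham N H M g' V) + of_real (g M - g' M) \<cdot>\<^sub>m V M
     = pert_ham N H (Suc M) g V - pert_ham N H (Suc M) g' V"
    using op_boundedD(1)[OF Suc.prems[of M]]
    by (intro eq_matI) (auto simp: pert_ham_def algebra_simps)
  ultimately show ?case by (simp del: of_real_diff)
qed

lemma hermitian_pert_ham:
  assumes "is_op N H" "hermitian H" "\<And>l. l < M \<Longrightarrow> is_op N (V l) \<and> hermitian (V l)"
  shows "hermitian (pert_ham N H M g V)"
proof -
  have 1: "H $$ (i, j) = cnj (H $$ (j, i))" if "i < 2 ^ N" "j < 2 ^ N" for i j
    using hermitianD[OF assms(2)] assms(1) that unfolding is_op_def by blast
  have 2: "V l $$ (i, j) = cnj (V l $$ (j, i))" if "l < M" "i < 2 ^ N" "j < 2 ^ N" for i j l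
    using hermitianD[of "V l"] assms(3) that unfolding is_op_def by blast
  have "H $$ (i, j) + (\<Sum>l<M. complex_of_real (g l) * V l $$ (i, j))
      = cnj (H $$ (j, i) + (\<Sum>l<M. complex_of_real (g l) * V l $$ (j, i)))"
    if ij: "i < 2 ^ N" "j < 2 ^ N" for i j
  proof -
    have "(\<Sum>l<M. complex_of_real (g l) * V l $$ (i, j)) = (\<Sum>l<M. complex_of_real (g l) * cnj (V l $$ (j, i)))"
      using 2[OF _ ij] by (intro sum.cong) auto
    then show ?thesis using 1[OF ij] by simp
  qed
  then show ?thesis
    unfolding hermitian_def by (auto simp: pert_ham_def)
qed

lemma chi_deformed_lipschitz:
  assumes "chi_deformed \<delta> Gam chi"
  shows "\<bar>chi x - chi y\<bar> \<le> \<delta> * \<bar>x - y\<bar>"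
proof -
  obtain D where D: "\<And>\<theta>. (chi has_real_derivative D \<theta>) (at \<theta>)" "\<And>\<theta>. \<bar>D \<theta>\<bar> \<le> \<delta>"
    using assms unfolding chi_deformed_def by metis
  have "norm (chi x - chi y) \<le> \<delta> * norm (x - y)"
    by (rule field_differentiable_bound[of UNIV chi D]) (use D in auto)
  then show ?thesis by simp
qed

theorem theorem5:
  shows "\<exists>c > 0. \<forall>(N::nat) (M::nat) (K::real) (k::nat) (H::complex mat) (V::nat \<Rightarrow> complex mat)
      (chi::nat \<Rightarrow> real \<Rightarrow> real) (\<delta>::real) (Gam::ereal) (t::real) (\<rho>::complex mat) (Ob::complex mat) (a::real).
      is_op N H \<and> hermitian H \<and>
      real M \<le> K * real N \<and>
      (\<forall>i < M. is_op N (V i) \<and> hermitian (V i) \<and> local_op N k (V i) \<and> op_norm (V i) \<le> 1) \<and>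
      \<delta> > 0 \<and> Gam > 0 \<and> (\<forall>i < M. chi_deformed \<delta> Gam (chi i)) \<and>
      t \<ge> 0 \<and> sqrt (real N) * t * \<delta> \<le> 1 \<and>
      density_matrix N \<rho> \<and> is_op N Ob \<and> hermitian Ob \<and> a > 0
      \<longrightarrow>
      (let f = (\<lambda>\<theta>. mtrace (\<rho> * heis (pert_ham N H M (\<lambda>i. chi i (\<theta> i)) V) t Ob))
       in prob_space.prob (gauss_space M)
            {\<theta> \<in> space (gauss_space M).
               cmod (f \<theta> - integral\<^sup>L (gauss_space M) f)
                 \<le> 2 * a * op_norm Ob * sqrt (real M) * t * \<delta>}
          \<ge> 1 - 2 * exp (- c * a\<^sup>2))"
proof (rule exI[of _ "1/16"], intro conjI allI impI)
  fix N M :: nat and K :: real and k :: nat and H :: "complex mat" and V :: "nat \<Rightarrow> complex mat"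
    and chi :: "nat \<Rightarrow> real \<Rightarrow> real" and \<delta> :: real and Gam :: ereal and t :: real
    and \<rho> Ob :: "complex mat" and a :: real
  assume asm: "is_op N H \<and> hermitian H \<and>
      real M \<le> K * real N \<and>
      (\<forall>i < M. is_op N (V i) \<and> hermitian (V i) \<and> local_op N k (V i) \<and> op_norm (V i) \<le> 1) \<and>
      \<delta> > 0 \<and> Gam > 0 \<and> (\<forall>i < M. chi_deformed \<delta> Gam (chi i)) \<and>
      t \<ge> 0 \<and> sqrt (real N) * t * \<delta> \<le> 1 \<and>
      density_matrix N \<rho> \<and> is_op N Ob \<and> hermitian Ob \<and> a > 0"
  define h where "h \<theta> = pert_ham N H M (\<lambda>i. chi i (\<theta> i)) V" for \<theta> :: "nat \<Rightarrow> real"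
  define f where "f \<theta> = mtrace (\<rho> * heis (h \<theta>) t Ob)" for \<theta>
  \<comment> \<open>The 2 counts the two terms of the commutator, \<open>\<delta>\<close> is the
    slope bound for the couplings, and \<open>t\<close> is the length of the interpolation.\<close>
  define L where "L = 2 * op_norm Ob * \<delta> * t"
  have rho: "density_matrix N \<rho>" and t: "0 \<le> t" and \<delta>: "0 < \<delta>" and a: "0 < a" using asm by auto
  have Ob: "op_bounded (2 ^ N) Ob (op_norm Ob)"
    using asm by (intro op_bounded_op_norm) (simp add: is_op_def)
  have V: "op_bounded (2 ^ N) (V l) 1" if "l < M" for l
    using op_bounded_mono[OF op_bounded_op_norm] asm that by (auto simp: is_op_def)
  have hc: "h \<theta> \<in> carrier_mat (2 ^ N) (2 ^ N)" "hermitian (h \<theta>)" for \<theta>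
    unfolding h_def using asm by (auto intro!: pert_ham_carrier hermitian_pert_ham)
  have lip: "l1_lipschitz M L f"
    unfolding l1_lipschitz_def
  proof (intro allI)
    fix x y :: "nat \<Rightarrow> real"
    let ?d = "\<Sum>i<M. \<bar>chi i (x i) - chi i (y i)\<bar>"
    have "op_bounded (2 ^ N) (h x - h y) ?d"
      unfolding h_def by (rule pert_ham_diff_bounded[OF V])
    then have "norm (f x - f y) \<le> 2 * op_norm Ob * ?d * t"
      unfolding f_def by (rule trace_heis_diff_bound[OF rho hc hc Ob _ t])
    also have "\<dots> \<le> 2 * op_norm Ob * (\<Sum>i<M. \<delta> * \<bar>x i - y i\<bar>) * t"
      using asm op_boundedD(2)[OF Ob] t
      by (intro mult_right_mono mult_left_mono sum_mono chi_deformed_lipschitz) auto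
    finally show "norm (f x - f y) \<le> L * (\<Sum>i<M. \<bar>x i - y i\<bar>)"
      by (simp add: L_def sum_distrib_left[symmetric] mult_ac)
  qed
  \<comment> \<open>Uniform in the couplings, even when they are unbounded, because the evolution is
    unitary; this makes \<open>f\<close> and all its exponential moments integrable.\<close>
  have bd: "cmod (f x) \<le> op_norm Ob" for x
    unfolding f_def by (rule density_trace_bound[OF rho op_bounded_heis[OF hc Ob]])
  have "0 \<le> L" unfolding L_def using op_boundedD(2)[OF Ob] t \<delta> by simp
  from gauss_space_concentration[OF lip bd a this]
  have "1 - 2 * exp (- (1/16) * a\<^sup>2) \<le> measure (gauss_space M) {\<theta> \<in> space (gauss_space M).
      cmod (f \<theta> - integral\<^sup>L (gauss_space M) f) \<le> a * (sqrt (real M) * L)}" .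
  also have "a * (sqrt (real M) * L) = 2 * a * op_norm Ob * sqrt (real M) * t * \<delta>"
    by (simp add: L_def)
  finally have conc: "1 - 2 * exp (- (1/16) * a\<^sup>2) \<le> measure (gauss_space M) {\<theta> \<in> space (gauss_space M).
      cmod (f \<theta> - integral\<^sup>L (gauss_space M) f) \<le> 2 * a * op_norm Ob * sqrt (real M) * t * \<delta>}" .
  show "let f = (\<lambda>\<theta>. mtrace (\<rho> * heis (pert_ham N H M (\<lambda>i. chi i (\<theta> i)) V) t Ob))
       in prob_space.prob (gauss_space M)
            {\<theta> \<in> space (gauss_space M).
               cmod (f \<theta> - integral\<^sup>L (gauss_space M) f)
                 \<le> 2 * a * op_norm Ob * sqrt (real M) * t * \<delta>}
          \<ge> 1 - 2 * exp (- (1/16) * a\<^sup>2)"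
    using conc unfolding Let_def f_def h_def .
qed simp

end
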